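(* Let $h>0$, let $f:\mathbb{R}\to\mathbb{R}$ and $d:C^1\to(-h,0)$ be continuously differentiable, and assume that $d$ has property (e,d). Define $F:C^1\to\mathbb{R}$ by $F(\phi)=f(\phi(d(\phi)))$. Let $b>0$ be such that $X_{F,b}\neq\emptyset$, and assume $$\sup_{\{\phi\in C^1:\,|\phi'(-h)|<b\}}|D_ed(\phi)|_{L_c(C,\mathbb{R})}<\infty.$$ Then there exists a diffeomorphism from $U_b$ onto an open subset of $C^1$ which maps $X_{F,b}$ onto an open subset of $X_0$.
   Context: $C=C([-h,0],\mathbb{R})$ is the Banach space of continuous functions with norm $|\phi|_C=\max_{-h\le t\le 0}|\phi(t)|$, and $C^1=C^1([-h,0],\mathbb{R})$ is the Banach space of continuously differentiable functions with norm $|\phi|_{C^1}=|\phi|_C+|\phi'|_C$. $L_c(C,\mathbb{R})$ is the space of continuous linear functionals on $C$ with the operator norm. Property (e,d): each derivative $Dd(\phi):C^1\to\mathbb{R}$, $\phi\in C^1$, has a linear extension $D_ed(\phi):C\to\mathbb{R}$ such that the map $C^1\times C\ni(\phi,\chi)\mapsto D_ed(\phi)\chi\in\mathbb{R}$ is continuous. For $b>0$, $U_b=\{\phi\in C^1:|\phi'(t)|<b\text{ for all }t\in[-h,d(\phi)]\}$ (an open subset of $C^1$), and $X_{F,b}=\{\phi\in U_b:\phi'(0)=F(\phi)\}$. Moreover $X_0=\{\phi\in C^1:\phi'(0)=0\}$, a closed subspace of $C^1$; "open subset of $X_0$" refers to the subspace topology. A diffeomorphism is a continuously differentiable (Fréchet)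 bijection between open subsets of Banach spaces with continuously differentiable inverse. *)

theory Defs
  imports "HOL-Analysis.Analysis"
begin

section \<open>The spaces of continuous and continuously differentiable functions on [-h,0]\<close>

text \<open>
  The length \<open>h\<close> is a real parameter, so the Banach spaces over [-h,0] are carrier sets rather than
  types. A continuous function on [-h,0] is represented by its extension to the real line that is
  constant on both sides of the interval. The representation is unique, and the supremum norm of
  the bounded continuous functions is the maximum norm over [-h,0]: see
  \<open>ex1_C_space\<close> and \<open>norm_C_space\<close> below.
\<close>

definition C_space :: "real \<Rightarrow> (real \<Rightarrow>\<^sub>C real) set" where
  "C_space h = {\<phi>. (\<forall>t\<le>-h. apply_bcontfun \<phi> t = apply_bcontfun \<phi> (-h)) \<and>
                    (\<forall>t\<ge>0. apply_bcontfun \<phi> t = apply_bcontfun \<phi> 0)}"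

text \<open>
  Derivatives are taken within [-h,0], hence one-sided at the end points. (The constant extension
  of a continuously differentiable function on [-h,0] need not be differentiable there.)
\<close>

definition C1_space :: "real \<Rightarrow> (real \<Rightarrow>\<^sub>C real) set" where
  "C1_space h = {\<phi> \<in> C_space h. \<exists>\<psi>. continuous_on {-h..0} \<psi> \<and>
     (\<forall>t\<in>{-h..0}. (apply_bcontfun \<phi> has_real_derivative \<psi> t) (at t within {-h..0}))}"

definition seg_deriv :: "real \<Rightarrow> (real \<Rightarrow>\<^sub>C real) \<Rightarrow> real \<Rightarrow> real" where
  "seg_deriv h \<phi> t = vector_derivative (apply_bcontfun \<phi>) (at t within {-h..0})"

text \<open>The value 0 off the carrier makes the induced distance satisfy \<open>Metric_space\<close>, which asks for
  nonnegativity and symmetry on the whole type.\<close>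

definition C1_norm :: "real \<Rightarrow> (real \<Rightarrow>\<^sub>C real) \<Rightarrow> real" where
  "C1_norm h \<phi> =
     (if \<phi> \<in> C1_space h then norm \<phi> + (SUP t\<in>{-h..0}. \<bar>seg_deriv h \<phi> t\<bar>) else 0)"


section \<open>Differential calculus on normed carriers\<close>

text \<open>In this section a normed space is a linear subspace \<open>E\<close> of a vector space together with a
  function \<open>nE\<close> that is a norm on \<open>E\<close>.\<close>

definition norm_topology :: "'a::real_vector set \<Rightarrow> ('a \<Rightarrow> real) \<Rightarrow> 'a topology" where
  "norm_topology E nE = Metric_space.mtopology E (\<lambda>x y. nE (x - y))"

definition linear_within ::
  "'a::real_vector set \<Rightarrow> 'b::real_vector set \<Rightarrow> ('a \<Rightarrow> 'b) \<Rightarrow> bool" where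
  "linear_within E G L \<longleftrightarrow> L \<in> E \<rightarrow> G \<and>
     (\<forall>x\<in>E. \<forall>y\<in>E. L (x + y) = L x + L y) \<and> (\<forall>c. \<forall>x\<in>E. L (c *\<^sub>R x) = c *\<^sub>R L x)"

definition bounded_linear_within ::
  "'a::real_vector set \<Rightarrow> ('a \<Rightarrow> real) \<Rightarrow> 'b::real_vector set \<Rightarrow> ('b \<Rightarrow> real) \<Rightarrow> ('a \<Rightarrow> 'b) \<Rightarrow> bool" where
  "bounded_linear_within E nE G nG L \<longleftrightarrow>
     linear_within E G L \<and> (\<exists>K. \<forall>x\<in>E. nG (L x) \<le> K * nE x)"

definition op_norm ::
  "'a::real_vector set \<Rightarrow> ('a \<Rightarrow> real) \<Rightarrow> ('b::real_vector \<Rightarrow> real) \<Rightarrow> ('a \<Rightarrow> 'b) \<Rightarrow> real" where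
  "op_norm E nE nG L = (SUP x\<in>{x\<in>E. nE x \<le> 1}. nG (L x))"

text \<open>\<open>L\<close> is the Frechet derivative at \<open>x\<close> of the map \<open>g\<close>, defined on the open set \<open>U\<close>. Only the
  restriction of \<open>L\<close> to \<open>E\<close> matters.\<close>

definition has_frechet_derivative ::
  "'a::real_vector set \<Rightarrow> ('a \<Rightarrow> real) \<Rightarrow> 'b::real_vector set \<Rightarrow> ('b \<Rightarrow> real) \<Rightarrow>
   'a set \<Rightarrow> ('a \<Rightarrow> 'b) \<Rightarrow> ('a \<Rightarrow> 'b) \<Rightarrow> 'a \<Rightarrow> bool" where
  "has_frechet_derivative E nE G nG U g L x \<longleftrightarrow>
     bounded_linear_within E nE G nG L \<and>
     (\<forall>e>0. \<exists>\<delta>>0. \<forall>y\<in>U. nE (y - x) < \<delta> \<longrightarrow> nG (g y - g x - L (y - x)) \<le> e * nE (y - x))"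

definition C1_map_on ::
  "'a::real_vector set \<Rightarrow> ('a \<Rightarrow> real) \<Rightarrow> 'b::real_vector set \<Rightarrow> ('b \<Rightarrow> real) \<Rightarrow>
   'a set \<Rightarrow> ('a \<Rightarrow> 'b) \<Rightarrow> bool" where
  "C1_map_on E nE G nG U g \<longleftrightarrow>
     openin (norm_topology E nE) U \<and> g \<in> U \<rightarrow> G \<and>
     (\<exists>D. (\<forall>x\<in>U. has_frechet_derivative E nE G nG U g (D x) x) \<and>
          (\<forall>x\<in>U. \<forall>e>0. \<exists>\<delta>>0. \<forall>y\<in>U. nE (y - x) < \<delta> \<longrightarrow>
             op_norm E nE nG (\<lambda>v. D y v - D x v) < e))"

definition diffeomorphism_on ::
  "'a::real_vector set \<Rightarrow> ('a \<Rightarrow> real) \<Rightarrow> 'b::real_vector set \<Rightarrow> ('b \<Rightarrow> real) \<Rightarrow>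
   'a set \<Rightarrow> 'b set \<Rightarrow> ('a \<Rightarrow> 'b) \<Rightarrow> bool" where
  "diffeomorphism_on E nE G nG U W g \<longleftrightarrow>
     openin (norm_topology E nE) U \<and> openin (norm_topology G nG) W \<and> bij_betw g U W \<and>
     C1_map_on E nE G nG U g \<and> C1_map_on G nG E nE W (inv_into U g)"


section \<open>The delay functional and the solution manifold\<close>

definition C1_top :: "real \<Rightarrow> (real \<Rightarrow>\<^sub>C real) topology" where
  "C1_top h = norm_topology (C1_space h) (C1_norm h)"

text \<open>Property (e,d), with the extended derivatives given by \<open>De\<close>. They are unique, because
  each \<open>De \<phi>\<close> is continuous on \<open>C_space h\<close>, in which \<open>C1_space h\<close> is dense.\<close>

definition extended_derivative ::
  "real \<Rightarrow> ((real \<Rightarrow>\<^sub>C real) \<Rightarrow> real) \<Rightarrow> ((real \<Rightarrow>\<^sub>C real) \<Rightarrow> (real \<Rightarrow>\<^sub>C real) \<Rightarrow> real) \<Rightarrow> bool" where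
  "extended_derivative h d De \<longleftrightarrow>
     (\<forall>\<phi>\<in>C1_space h. linear_within (C_space h) UNIV (De \<phi>) \<and>
        has_frechet_derivative (C1_space h) (C1_norm h) UNIV abs (C1_space h) d (De \<phi>) \<phi>) \<and>
     continuous_map (prod_topology (C1_top h) (top_of_set (C_space h))) euclideanreal
       (\<lambda>(\<phi>, \<eta>). De \<phi> \<eta>)"

definition U_set :: "real \<Rightarrow> ((real \<Rightarrow>\<^sub>C real) \<Rightarrow> real) \<Rightarrow> real \<Rightarrow> (real \<Rightarrow>\<^sub>C real) set" where
  "U_set h d b = {\<phi> \<in> C1_space h. \<forall>t\<in>{-h..d \<phi>}. \<bar>seg_deriv h \<phi> t\<bar> < b}"

definition X_set :: "real \<Rightarrow> ((real \<Rightarrow>\<^sub>C real) \<Rightarrow> real) \<Rightarrow> real \<Rightarrow> ((real \<Rightarrow>\<^sub>C real) \<Rightarrow> real) \<Rightarrow>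
    (real \<Rightarrow>\<^sub>C real) set" where
  "X_set h d b F = {\<phi> \<in> U_set h d b. seg_deriv h \<phi> 0 = F \<phi>}"

definition X0_space :: "real \<Rightarrow> (real \<Rightarrow>\<^sub>C real) set" where
  "X0_space h = {\<phi> \<in> C1_space h. seg_deriv h \<phi> 0 = 0}"


section \<open>Basic facts about the representation\<close>

lemma C_space_eq:
  assumes "0 \<le> h"
  shows "\<phi> \<in> C_space h \<longleftrightarrow> (\<forall>t. apply_bcontfun \<phi> t = apply_bcontfun \<phi> (max (-h) (min 0 t)))"
proof -
  have l: "max (-h) (min 0 t) = -h" if "t \<le> -h" for t using that by simp
  have r: "max (-h) (min 0 t) = 0" if "t \<ge> 0" for t using that assms by simp
  have m: "max (-h) (min 0 t) = t" if "\<not> t \<le> -h" "\<not> t \<ge> 0" for t using that by simp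
  show ?thesis
  proof
    assume "\<phi> \<in> C_space h"
    then have a: "\<forall>t\<le>-h. apply_bcontfun \<phi> t = apply_bcontfun \<phi> (-h)"
      and b: "\<forall>t\<ge>0. apply_bcontfun \<phi> t = apply_bcontfun \<phi> 0"
      unfolding C_space_def by blast+
    show "\<forall>t. apply_bcontfun \<phi> t = apply_bcontfun \<phi> (max (-h) (min 0 t))"
    proof
      fix t
      show "apply_bcontfun \<phi> t = apply_bcontfun \<phi> (max (-h) (min 0 t))"
        using a b l[of t] r[of t] m[of t] by metis
    qed
  next
    assume e: "\<forall>t. apply_bcontfun \<phi> t = apply_bcontfun \<phi> (max (-h) (min 0 t))"
    have "apply_bcontfun \<phi> t = apply_bcontfun \<phi> (-h)" if "t \<le> -h" for t
      using e[rule_format, of t] unfolding l[OF that] .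
    moreover have "apply_bcontfun \<phi> t = apply_bcontfun \<phi> 0" if "t \<ge> 0" for t
      using e[rule_format, of t] unfolding r[OF that] .
    ultimately show "\<phi> \<in> C_space h" unfolding C_space_def by blast
  qed
qed

lemma subspace_C_space: "subspace (C_space h)"
  unfolding subspace_def
proof (intro conjI ballI allI)
  show "(0 :: real \<Rightarrow>\<^sub>C real) \<in> C_space h"
    by (simp add: C_space_def zero_bcontfun.rep_eq)
next
  fix \<phi> \<psi> assume "\<phi> \<in> C_space h" "\<psi> \<in> C_space h"
  then show "\<phi> + \<psi> \<in> C_space h"
    unfolding C_space_def plus_bcontfun.rep_eq mem_Collect_eq by metis
next
  fix c \<phi> assume "\<phi> \<in> C_space h"
  then show "c *\<^sub>R \<phi> \<in> C_space h"
    unfolding C_space_def scaleR_bcontfun.rep_eq mem_Collect_eq by metis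
qed

lemma norm_C_space:
  assumes "0 \<le> h" "\<phi> \<in> C_space h"
  shows "norm \<phi> = (SUP t\<in>{-h..0}. \<bar>apply_bcontfun \<phi> t\<bar>)"
proof (rule antisym)
  have bdd: "bdd_above ((\<lambda>t. \<bar>apply_bcontfun \<phi> t\<bar>) ` {-h..0})"
    by (intro compact_imp_bounded[THEN bounded_imp_bdd_above] compact_continuous_image
        continuous_on_rabs continuous_on_apply_bcontfun compact_Icc)
  show "norm \<phi> \<le> (SUP t\<in>{-h..0}. \<bar>apply_bcontfun \<phi> t\<bar>)"
  proof (rule norm_bound)
    fix t
    have "apply_bcontfun \<phi> t = apply_bcontfun \<phi> (max (-h) (min 0 t))"
      using assms(2) C_space_eq[OF assms(1), of \<phi>] by blast
    moreover have "\<bar>apply_bcontfun \<phi> (max (-h) (min 0 t))\<bar> \<le> (SUP t\<in>{-h..0}. \<bar>apply_bcontfun \<phi> t\<bar>)"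
      using assms by (intro cSUP_upper[OF _ bdd]) auto
    ultimately show "norm (apply_bcontfun \<phi> t) \<le> (SUP t\<in>{-h..0}. \<bar>apply_bcontfun \<phi> t\<bar>)" by simp
  qed
  show "(SUP t\<in>{-h..0}. \<bar>apply_bcontfun \<phi> t\<bar>) \<le> norm \<phi>"
    using assms norm_bounded[of \<phi>] by (intro cSUP_least) auto
qed

lemma ex1_C_space:
  fixes g :: "real \<Rightarrow> real"
  assumes "0 \<le> h" "continuous_on {-h..0} g"
  shows "\<exists>!\<phi>. \<phi> \<in> C_space h \<and> (\<forall>t\<in>{-h..0}. apply_bcontfun \<phi> t = g t)"
proof -
  let ?p = "\<lambda>t::real. max (-h) (min 0 t)"
  have pI: "?p t \<in> {-h..0}" for t using assms(1) by simp
  then have p: "range ?p \<subseteq> {-h..0}" by (rule image_subsetI)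
  have c: "continuous_on UNIV (g \<circ> ?p)"
    by (rule continuous_on_compose[OF _ continuous_on_subset[OF assms(2) p]])
      (intro continuous_on_max continuous_on_min continuous_on_const continuous_on_id)
  have "range (g \<circ> ?p) \<subseteq> g ` {-h..0}"
    unfolding image_comp[symmetric] using p by (rule image_mono)
  then have "bounded (range (g \<circ> ?p))"
    by (rule bounded_subset[OF compact_imp_bounded[OF compact_continuous_image[OF assms(2) compact_Icc]]])
  with c obtain \<phi> where \<phi>: "g \<circ> ?p = apply_bcontfun \<phi>"
    using bcontfunE[of "g \<circ> ?p"] unfolding bcontfun_def mem_Collect_eq by metis
  have ev: "apply_bcontfun \<phi> t = g (?p t)" for t
    using fun_cong[OF \<phi>, of t] unfolding comp_def by (rule sym)
  have pp: "?p (?p t) = ?p t" for t using assms(1) by simp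
  have pt: "?p t = t" if "t \<in> {-h..0}" for t using that by simp
  have "\<phi> \<in> C_space h" unfolding C_space_eq[OF assms(1)] ev pp by (intro allI refl)
  moreover have "apply_bcontfun \<phi> t = g t" if "t \<in> {-h..0}" for t unfolding ev pt[OF that] ..
  ultimately have ex: "\<phi> \<in> C_space h \<and> (\<forall>t\<in>{-h..0}. apply_bcontfun \<phi> t = g t)" by blast
  have "\<psi> = \<phi>" if \<psi>: "\<psi> \<in> C_space h \<and> (\<forall>t\<in>{-h..0}. apply_bcontfun \<psi> t = g t)" for \<psi>
  proof (rule bcontfun_eqI)
    fix t
    have "apply_bcontfun \<psi> t = apply_bcontfun \<psi> (?p t)"
      using \<psi> C_space_eq[OF assms(1), of \<psi>] by blast
    also have "\<dots> = g (?p t)" using \<psi> pI[of t] by blast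
    finally show "apply_bcontfun \<psi> t = apply_bcontfun \<phi> t" unfolding ev .
  qed
  with ex show ?thesis by (rule ex1I)
qed

lemma seg_deriv_eqI:
  assumes "0 < h" "t \<in> {-h..0}" "(apply_bcontfun \<phi> has_real_derivative D) (at t within {-h..0})"
  shows "seg_deriv h \<phi> t = D"
  unfolding seg_deriv_def
  using assms vector_derivative_within_cbox[of "-h" 0 t "apply_bcontfun \<phi>" D]
  by (auto simp: has_real_derivative_iff_has_vector_derivative)

lemma C1_spaceD:
  assumes "0 < h" "\<phi> \<in> C1_space h"
  shows "continuous_on {-h..0} (seg_deriv h \<phi>)"
    and "t \<in> {-h..0} \<Longrightarrow>
      (apply_bcontfun \<phi> has_real_derivative seg_deriv h \<phi> t) (at t within {-h..0})"
proof -
  obtain \<psi> where c: "continuous_on {-h..0} \<psi>" and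
    d: "\<And>t. t \<in> {-h..0} \<Longrightarrow> (apply_bcontfun \<phi> has_real_derivative \<psi> t) (at t within {-h..0})"
    using assms by (auto simp: C1_space_def)
  have e: "seg_deriv h \<phi> t = \<psi> t" if "t \<in> {-h..0}" for t
    using seg_deriv_eqI[OF assms(1) that d[OF that]] .
  show "continuous_on {-h..0} (seg_deriv h \<phi>)"
    by (rule continuous_on_eq[OF c]) (simp add: e)
  show "t \<in> {-h..0} \<Longrightarrow>
      (apply_bcontfun \<phi> has_real_derivative seg_deriv h \<phi> t) (at t within {-h..0})"
    using d e by simp
qed

lemma C1_add_scaleR:
  assumes "0 < h" "\<phi> \<in> C1_space h" "\<psi> \<in> C1_space h"
  shows "a *\<^sub>R \<phi> + c *\<^sub>R \<psi> \<in> C1_space h"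
    and "t \<in> {-h..0} \<Longrightarrow>
      seg_deriv h (a *\<^sub>R \<phi> + c *\<^sub>R \<psi>) t = a * seg_deriv h \<phi> t + c * seg_deriv h \<psi> t"
proof -
  have e: "apply_bcontfun (a *\<^sub>R \<phi> + c *\<^sub>R \<psi>) =
      (\<lambda>t. a * apply_bcontfun \<phi> t + c * apply_bcontfun \<psi> t)"
    by (auto simp: plus_bcontfun.rep_eq scaleR_bcontfun.rep_eq)
  have d: "(apply_bcontfun (a *\<^sub>R \<phi> + c *\<^sub>R \<psi>) has_real_derivative
      a * seg_deriv h \<phi> t + c * seg_deriv h \<psi> t) (at t within {-h..0})" if "t \<in> {-h..0}" for t
    unfolding e using C1_spaceD(2)[OF assms(1,2) that] C1_spaceD(2)[OF assms(1,3) that]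
    by (auto intro!: derivative_eq_intros)
  have "a *\<^sub>R \<phi> + c *\<^sub>R \<psi> \<in> C_space h"
    using assms by (intro subspace_add subspace_scale subspace_C_space) (auto simp: C1_space_def)
  moreover have "continuous_on {-h..0} (\<lambda>t. a * seg_deriv h \<phi> t + c * seg_deriv h \<psi> t)"
    using C1_spaceD(1)[OF assms(1,2)] C1_spaceD(1)[OF assms(1,3)] by (intro continuous_intros)
  ultimately show "a *\<^sub>R \<phi> + c *\<^sub>R \<psi> \<in> C1_space h"
    using d unfolding C1_space_def by blast
  show "t \<in> {-h..0} \<Longrightarrow>
      seg_deriv h (a *\<^sub>R \<phi> + c *\<^sub>R \<psi>) t = a * seg_deriv h \<phi> t + c * seg_deriv h \<psi> t"
    using seg_deriv_eqI[OF assms(1) _ d] .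
qed

lemma subspace_C1_space:
  assumes "0 < h" shows "subspace (C1_space h)"
proof -
  have "(0 :: real \<Rightarrow>\<^sub>C real) \<in> C1_space h"
    unfolding C1_space_def using subspace_0[OF subspace_C_space[of h]]
    by (auto intro!: exI[of _ "\<lambda>_. 0"] simp: zero_bcontfun.rep_eq)
  then show ?thesis
    using C1_add_scaleR(1)[OF assms, of _ _ 1 1] C1_add_scaleR(1)[OF assms, of _ _ _ 0]
    by (force simp: subspace_def)
qed

lemma bdd_above_seg_deriv:
  assumes "0 < h" "\<phi> \<in> C1_space h"
  shows "bdd_above ((\<lambda>t. \<bar>seg_deriv h \<phi> t\<bar>) ` {-h..0})"
  by (intro compact_imp_bounded[THEN bounded_imp_bdd_above] compact_continuous_image
      continuous_intros C1_spaceD assms) auto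

lemma C1_norm_ge_norm:
  assumes "0 < h" "\<phi> \<in> C1_space h"
  shows "norm \<phi> \<le> C1_norm h \<phi>"
proof -
  have "\<bar>seg_deriv h \<phi> 0\<bar> \<le> (SUP t\<in>{-h..0}. \<bar>seg_deriv h \<phi> t\<bar>)"
    using assms by (intro cSUP_upper bdd_above_seg_deriv) auto
  then show ?thesis using assms by (simp add: C1_norm_def)
qed

lemma C1_norm_scaleR_le:
  assumes "0 < h" "\<phi> \<in> C1_space h"
  shows "C1_norm h (c *\<^sub>R \<phi>) \<le> \<bar>c\<bar> * C1_norm h \<phi>"
proof -
  have "(SUP t\<in>{-h..0}. \<bar>seg_deriv h (c *\<^sub>R \<phi>) t\<bar>) \<le> \<bar>c\<bar> * (SUP t\<in>{-h..0}. \<bar>seg_deriv h \<phi> t\<bar>)"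
    using C1_add_scaleR(2)[OF assms assms(2), of _ c 0] assms
    by (intro cSUP_least)
      (auto simp: abs_mult intro!: mult_left_mono cSUP_upper[OF _ bdd_above_seg_deriv[OF assms]])
  then show ?thesis
    using assms subspace_scale[OF subspace_C1_space[OF assms(1)] assms(2)]
    by (simp add: C1_norm_def distrib_left)
qed

lemma C1_norm_triangle:
  assumes "0 < h" "\<phi> \<in> C1_space h" "\<psi> \<in> C1_space h"
  shows "C1_norm h (\<phi> + \<psi>) \<le> C1_norm h \<phi> + C1_norm h \<psi>"
proof -
  have "(SUP t\<in>{-h..0}. \<bar>seg_deriv h (\<phi> + \<psi>) t\<bar>) \<le>
      (SUP t\<in>{-h..0}. \<bar>seg_deriv h \<phi> t\<bar>) + (SUP t\<in>{-h..0}. \<bar>seg_deriv h \<psi> t\<bar>)"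
  proof (rule cSUP_least)
    fix t assume t: "t \<in> {-h..0}"
    have "\<bar>seg_deriv h (\<phi> + \<psi>) t\<bar> \<le> \<bar>seg_deriv h \<phi> t\<bar> + \<bar>seg_deriv h \<psi> t\<bar>"
      using C1_add_scaleR(2)[OF assms t, of 1 1] by simp
    also have "\<dots> \<le> (SUP t\<in>{-h..0}. \<bar>seg_deriv h \<phi> t\<bar>) + (SUP t\<in>{-h..0}. \<bar>seg_deriv h \<psi> t\<bar>)"
      using t assms by (intro add_mono cSUP_upper bdd_above_seg_deriv)
    finally show "\<bar>seg_deriv h (\<phi> + \<psi>) t\<bar> \<le> \<dots>" .
  qed (use assms in auto)
  then show ?thesis
    using assms subspace_add[OF subspace_C1_space[OF assms(1)] assms(2,3)] norm_triangle_ineq[of \<phi> \<psi>]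
    by (simp add: C1_norm_def)
qed

lemma C1_norm_minus: 
  assumes "0 < h" shows "C1_norm h (- \<phi>) = C1_norm h \<phi>"
proof (cases "\<phi> \<in> C1_space h")
  case True
  then have "- \<phi> \<in> C1_space h" using subspace_neg[OF subspace_C1_space[OF assms]] by blast
  then show ?thesis
    using C1_norm_scaleR_le[OF assms True, of "-1"] C1_norm_scaleR_le[OF assms, of "-\<phi>" "-1"]
    by simp
next
  case False
  then have "- \<phi> \<notin> C1_space h" using subspace_neg[OF subspace_C1_space[OF assms], of "-\<phi>"] by auto
  then show ?thesis using False by (simp add: C1_norm_def)
qed

lemma Metric_space_C1:
  assumes "0 < h"
  shows "Metric_space (C1_space h) (\<lambda>\<phi> \<psi>. C1_norm h (\<phi> - \<psi>))"
proof
  note sub = subspace_C1_space[OF assms]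
  fix \<phi> \<psi> \<eta> :: "real \<Rightarrow>\<^sub>C real"
  show "0 \<le> C1_norm h (\<phi> - \<psi>)"
    using C1_norm_ge_norm[OF assms, of "\<phi> - \<psi>"] norm_ge_zero[of "\<phi> - \<psi>"]
    by (cases "\<phi> - \<psi> \<in> C1_space h") (auto simp: C1_norm_def)
  show "C1_norm h (\<phi> - \<psi>) = C1_norm h (\<psi> - \<phi>)"
    using C1_norm_minus[OF assms, of "\<phi> - \<psi>"] by simp
  assume \<phi>: "\<phi> \<in> C1_space h" and \<psi>: "\<psi> \<in> C1_space h"
  have "C1_norm h 0 = 0"
    using C1_norm_scaleR_le[OF assms \<phi>, of 0] C1_norm_ge_norm[OF assms subspace_0[OF sub]] by simp
  then show "C1_norm h (\<phi> - \<psi>) = 0 \<longleftrightarrow> \<phi> = \<psi>"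
    using C1_norm_ge_norm[OF assms subspace_diff[OF sub \<phi> \<psi>]] by auto
  assume \<eta>: "\<eta> \<in> C1_space h"
  show "C1_norm h (\<phi> - \<eta>) \<le> C1_norm h (\<phi> - \<psi>) + C1_norm h (\<psi> - \<eta>)"
    using C1_norm_triangle[OF assms subspace_diff[OF sub \<phi> \<psi>] subspace_diff[OF sub \<psi> \<eta>]] by simp
qed

end

theory Submission
  imports Defs
begin

text \<open>
  Write \<open>G \<phi> = \<phi> (d \<phi>)\<close>, so that \<open>F = f \<circ> G\<close>. The diffeomorphism is \<open>\<Phi> \<phi> = \<phi> - H (G \<phi>)\<close> with a
  continuously differentiable curve \<open>H\<close> in \<open>C1_space h\<close> such that \<open>(H s)' (0) = f s\<close>; then
  \<open>(\<Phi> \<phi>)' (0) = \<phi>' (0) - F \<phi>\<close>, so \<open>\<Phi>\<close> takes the solution manifold into \<open>X0_space h\<close>.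
  If the extended derivatives of \<open>d\<close> are bounded by \<open>K\<close>, then \<open>d\<close> is \<open>K\<close>-Lipschitz in the sup norm on
  the convex set \<open>|\<phi>' (-h)| < b\<close>, and \<open>G\<close> is Lipschitz in the sup norm on \<open>U_set h d b\<close> with constant
  \<open>L = 1 + b K\<close>. As \<open>H\<close> can be chosen \<open>c\<close>-Lipschitz in the sup norm with \<open>L c \<le> 1/2\<close>, recovering \<open>\<phi>\<close>
  from \<open>q = \<Phi> \<phi>\<close> reduces to the scalar equation \<open>s = G (q + H s)\<close>, whose right-hand side is a contraction.
\<close>

section \<open>Calculus on normed carriers\<close>

text \<open>The condition \<open>(H s)' (0) = f s\<close> forces
  \<open>(\<eta> s)' (0) = f' s\<close> for the derivative \<open>\<eta>\<close> of
  \<open>H\<close>, and \<open>f'\<close> is under no control. So \<Phi> cannot be made a small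
  perturbation of the identity in the C1 norm, and two norms run through the proof: smallness is
  measured in the sup norm, differentiability in the C1 norm. This is why the extended derivatives
  matter: through them the derivative of \<open>G\<close> in direction \<open>v\<close> is bounded
  by \<open>L * norm v\<close>, without the derivative of \<open>v\<close>. The restriction of
  \<phi>' on \<open>U_set h d b\<close> bounds the other factor, the change of \<phi> when the delay
  moves. The single inequality \<open>L * c \<le> 1/2\<close> yields both the invertibility of
  \<Phi> and that of its derivative. The latter differs from the identity by a map of rank one, so
  its inverse is an explicit formula, and the smoothness of the inverse map is checked with it
  directly.\<close>

locale normed_carrier =
  fixes E :: "'a::real_normed_vector set" and n :: "'a \<Rightarrow> real"
  assumes subspace: "subspace E"
    and n_nonneg: "0 \<le> n x"
    and n_minus: "n (- x) = n x"
    and n_scaleR: "x \<in> E \<Longrightarrow> n (c *\<^sub>R x) \<le> \<bar>c\<bar> * n x"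
    and n_add: "x \<in> E \<Longrightarrow> y \<in> E \<Longrightarrow> n (x + y) \<le> n x + n y"
    and norm_le_n: "x \<in> E \<Longrightarrow> norm x \<le> n x"
begin

lemmas zero_mem = subspace_0[OF subspace]
  and add_mem = subspace_add[OF subspace]
  and diff_mem = subspace_diff[OF subspace]
  and scaleR_mem = subspace_scale[OF subspace]

lemma n_zero: "n 0 = 0"
  using n_scaleR[OF zero_mem, of 0] n_nonneg[of 0] by simp

lemma n_commute: "n (x - y) = n (y - x)"
  using n_minus[of "x - y"] by simp

lemma n_diff: "x \<in> E \<Longrightarrow> y \<in> E \<Longrightarrow> n (x - y) \<le> n x + n y"
  using n_add[of x "- y"] subspace_neg[OF subspace] by (simp add: n_minus)

lemma Metric_space: "Metric_space E (\<lambda>x y. n (x - y))"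
proof
  fix x y z
  show "0 \<le> n (x - y)" by (rule n_nonneg)
  show "n (x - y) = n (y - x)" by (rule n_commute)
  assume x: "x \<in> E" and y: "y \<in> E"
  \<comment> \<open>Definiteness is inherited from the ambient norm, which \<open>n\<close>
    dominates on \<open>E\<close>.\<close>
  show "n (x - y) = 0 \<longleftrightarrow> x = y"
    using norm_le_n[OF diff_mem[OF x y]] n_zero by auto
  assume z: "z \<in> E"
  show "n (x - z) \<le> n (x - y) + n (y - z)"
    using n_add[OF diff_mem[OF x y] diff_mem[OF y z]] by simp
qed

lemma openin_iff:
  "openin (norm_topology E n) U \<longleftrightarrow>
     U \<subseteq> E \<and> (\<forall>x\<in>U. \<exists>r>0. \<forall>y\<in>E. n (y - x) < r \<longrightarrow> y \<in> U)"
proof -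
  interpret M: Metric_space E "\<lambda>x y. n (x - y)" by (rule Metric_space)
  have "M.mball x r \<subseteq> U \<longleftrightarrow> (\<forall>y\<in>E. n (y - x) < r \<longrightarrow> y \<in> U)" if "x \<in> E" for x r
    using that by (auto simp: M.mball_def n_commute)
  then show ?thesis
    unfolding norm_topology_def M.openin_mtopology by blast
qed

lemma op_norm_le:
  assumes "\<And>v. v \<in> E \<Longrightarrow> nG (L v) \<le> B * n v" "0 \<le> B"
  shows "op_norm E n nG L \<le> B"
  unfolding op_norm_def
proof (rule cSUP_least)
  show "{x \<in> E. n x \<le> 1} \<noteq> {}" using zero_mem n_zero by auto
  fix v assume "v \<in> {x \<in> E. n x \<le> 1}"
  then show "nG (L v) \<le> B"
    using assms mult_left_mono[of "n v" 1 B] by force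
qed

text \<open>The constant \<open>K\<close> is absent from the conclusion: it shows that the set under
  the supremum in \<open>op_norm\<close> is bounded above, so that the supremum is a genuine
  one.\<close>

lemma le_op_norm:
  assumes lin: "linear_within E UNIV L"
    and bd: "\<And>v. v \<in> E \<Longrightarrow> \<bar>L v\<bar> \<le> K * n v" and v: "v \<in> E"
  shows "\<bar>L v\<bar> \<le> op_norm E n abs L * n v"
proof (cases "n v = 0")
  case True
  then show ?thesis using bd[OF v] by simp
next
  case False
  then have pos: "n v > 0" using n_nonneg[of v] by simp
  let ?u = "(1 / n v) *\<^sub>R v"
  have u: "?u \<in> E" "n ?u \<le> 1"
    using n_scaleR[OF v, of "1 / n v"] pos scaleR_mem[OF v] by auto
  have "bdd_above ((\<lambda>x. \<bar>L x\<bar>) ` {x \<in> E. n x \<le> 1})"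
  proof (rule bdd_aboveI2)
    fix x assume x: "x \<in> {x \<in> E. n x \<le> 1}"
    have "\<bar>L x\<bar> \<le> K * n x" using bd x by auto
    also have "\<dots> \<le> \<bar>K\<bar> * 1" using x n_nonneg[of x] by (intro mult_mono) auto
    finally show "\<bar>L x\<bar> \<le> \<bar>K\<bar>" by simp
  qed
  then have "\<bar>L ?u\<bar> \<le> op_norm E n abs L"
    unfolding op_norm_def using u by (intro cSUP_upper) auto
  moreover have "L ?u = L v / n v"
    using lin v by (simp add: linear_within_def)
  ultimately show ?thesis
    using pos by (simp add: field_simps)
qed

text \<open>Eventual statements along this filter are exactly the \<delta>-clauses of
  \<open>has_frechet_derivative\<close> and \<open>C1_map_on\<close>. Estimates can then be combined
  by \<open>eventually_elim\<close> and limit rules instead of minima of radii.\<close>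

definition nbhd :: "'a set \<Rightarrow> 'a \<Rightarrow> 'a filter" where
  "nbhd U x = inf (filtercomap (\<lambda>y. n (y - x)) (nhds 0)) (principal U)"

lemma eventually_nbhd:
  "eventually P (nbhd U x) \<longleftrightarrow> (\<exists>\<delta>>0. \<forall>y\<in>U. n (y - x) < \<delta> \<longrightarrow> P y)"
proof -
  have "eventually P (nbhd U x) \<longleftrightarrow> (\<exists>Q. eventually Q (nhds 0) \<and> (\<forall>y\<in>U. Q (n (y - x)) \<longrightarrow> P y))"
    unfolding nbhd_def eventually_inf_principal eventually_filtercomap by auto
  also have "\<dots> \<longleftrightarrow> (\<exists>\<delta>>0. \<forall>y\<in>U. n (y - x) < \<delta> \<longrightarrow> P y)"
  proof
    assume "\<exists>Q. eventually Q (nhds 0) \<and> (\<forall>y\<in>U. Q (n (y - x)) \<longrightarrow> P y)"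
    then obtain Q \<delta> where "\<delta> > 0" "\<And>r. dist r 0 < \<delta> \<Longrightarrow> Q r" "\<And>y. y \<in> U \<Longrightarrow> Q (n (y - x)) \<Longrightarrow> P y"
      unfolding eventually_nhds_metric by blast
    then show "\<exists>\<delta>>0. \<forall>y\<in>U. n (y - x) < \<delta> \<longrightarrow> P y"
      using n_nonneg by (intro exI[of _ \<delta>]) auto
  next
    assume "\<exists>\<delta>>0. \<forall>y\<in>U. n (y - x) < \<delta> \<longrightarrow> P y"
    then obtain \<delta> where "\<delta> > 0" "\<forall>y\<in>U. n (y - x) < \<delta> \<longrightarrow> P y" by blast
    then show "\<exists>Q. eventually Q (nhds 0) \<and> (\<forall>y\<in>U. Q (n (y - x)) \<longrightarrow> P y)"
      by (intro exI[of _ "\<lambda>r. r < \<delta>"]) (auto intro: order_tendstoD(2)[OF filterlim_ident])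
  qed
  finally show ?thesis .
qed

lemma eventually_nbhd_mem: "eventually (\<lambda>y. y \<in> U) (nbhd U x)"
  by (auto simp: eventually_nbhd intro!: exI[of _ 1])

lemma tendsto_nbhd: "((\<lambda>y. n (y - x)) \<longlongrightarrow> 0) (nbhd U x)"
  unfolding tendsto_iff eventually_nbhd using n_nonneg by (auto simp: dist_real_def)

text \<open>Continuity of the derivative is asked for vector by vector, with a bound proportional to
  \<open>n v\<close>, which keeps the supremum in \<open>op_norm\<close> out of the later
  estimates.\<close>

lemma C1_map_onI:
  fixes nG :: "'b::real_vector \<Rightarrow> real"
  assumes "openin (norm_topology E n) U" "g \<in> U \<rightarrow> G"
    and "\<And>x. x \<in> U \<Longrightarrow> bounded_linear_within E n G nG (D x)"
    and "\<And>x e. x \<in> U \<Longrightarrow> e > 0 \<Longrightarrow>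
      \<forall>\<^sub>F y in nbhd U x. nG (g y - g x - D x (y - x)) \<le> e * n (y - x)"
    and "\<And>x e. x \<in> U \<Longrightarrow> e > 0 \<Longrightarrow>
      \<forall>\<^sub>F y in nbhd U x. \<forall>v\<in>E. nG (D y v - D x v) \<le> e * n v"
  shows "C1_map_on E n G nG U g"
  unfolding C1_map_on_def has_frechet_derivative_def
proof (intro conjI exI[of _ D] ballI allI impI assms(1,2))
  fix x assume x: "x \<in> U"
  then show "bounded_linear_within E n G nG (D x)" by (rule assms(3))
  fix e :: real assume e: "e > 0"
  show "\<exists>\<delta>>0. \<forall>y\<in>U. n (y - x) < \<delta> \<longrightarrow> nG (g y - g x - D x (y - x)) \<le> e * n (y - x)"
    using assms(4)[OF x e] by (simp add: eventually_nbhd)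
  \<comment> \<open>A supremum only inherits a weak inequality, so \<open>e/2\<close> is used to end
    strictly below \<open>e\<close>.\<close>
  have "\<forall>\<^sub>F y in nbhd U x. \<forall>v\<in>E. nG (D y v - D x v) \<le> e/2 * n v"
    using assms(5)[OF x, of "e/2"] e by simp
  then have "\<forall>\<^sub>F y in nbhd U x. op_norm E n nG (\<lambda>v. D y v - D x v) < e"
  proof eventually_elim
    case (elim y)
    then have "op_norm E n nG (\<lambda>v. D y v - D x v) \<le> e/2"
      using e by (intro op_norm_le) auto
    then show ?case using e by simp
  qed
  then show "\<exists>\<delta>>0. \<forall>y\<in>U. n (y - x) < \<delta> \<longrightarrow> op_norm E n nG (\<lambda>v. D y v - D x v) < e"
    by (simp add: eventually_nbhd)
qed

lemma nbhd_mono: "U \<subseteq> V \<Longrightarrow> nbhd U x \<le> nbhd V x"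
  unfolding nbhd_def by (intro inf_mono) auto

text \<open>Restriction to a line turns a Frechet derivative into an ordinary one, to which the mean
  value theorem and \<open>DERIV_unique\<close> apply.\<close>

lemma frechet_derivative_along_line:
  assumes L: "has_frechet_derivative E n UNIV abs E g L (x + s *\<^sub>R v)" and x: "x \<in> E" and v: "v \<in> E"
  shows "((\<lambda>s. g (x + s *\<^sub>R v)) has_real_derivative L v) (at s within S)"
  unfolding has_field_derivative_def has_derivative_within_alt
proof (intro conjI allI impI bounded_linear_mult_right)
  fix e :: real assume e: "e > 0"
  have scale: "L (r *\<^sub>R v) = r * L v" for r
    using L v by (simp add: has_frechet_derivative_def bounded_linear_within_def linear_within_def)
  \<comment> \<open>The added 1 covers \<open>n v = 0\<close>.\<close>
  define e' where "e' = e / (n v + 1)"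
  have e': "e' > 0" "e' * n v \<le> e"
    using e n_nonneg[of v] by (auto simp: e'_def field_simps)
  obtain \<delta> where \<delta>: "\<delta> > 0" "\<And>y. y \<in> E \<Longrightarrow> n (y - (x + s *\<^sub>R v)) < \<delta> \<Longrightarrow>
      \<bar>g y - g (x + s *\<^sub>R v) - L (y - (x + s *\<^sub>R v))\<bar> \<le> e' * n (y - (x + s *\<^sub>R v))"
    using L e'(1) unfolding has_frechet_derivative_def by blast
  show "\<exists>\<delta>>0. \<forall>r\<in>S. norm (r - s) < \<delta> \<longrightarrow>
      norm (g (x + r *\<^sub>R v) - g (x + s *\<^sub>R v) - L v * (r - s)) \<le> e * norm (r - s)"
  proof (intro exI[of _ "\<delta> / (n v + 1)"] conjI ballI impI)
    show "0 < \<delta> / (n v + 1)" using \<delta>(1) n_nonneg[of v] by (simp add: add_nonneg_pos)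
    fix r assume r: "norm (r - s) < \<delta> / (n v + 1)"
    have eq: "x + r *\<^sub>R v - (x + s *\<^sub>R v) = (r - s) *\<^sub>R v" by (simp add: algebra_simps)
    have le: "n ((r - s) *\<^sub>R v) \<le> \<bar>r - s\<bar> * n v" by (rule n_scaleR[OF v])
    also have "\<dots> \<le> \<bar>r - s\<bar> * (n v + 1)" by (intro mult_left_mono) auto
    also have "\<dots> < \<delta>" using r n_nonneg[of v] by (simp add: field_simps add_nonneg_pos)
    finally have "n (x + r *\<^sub>R v - (x + s *\<^sub>R v)) < \<delta>" unfolding eq .
    then have "\<bar>g (x + r *\<^sub>R v) - g (x + s *\<^sub>R v) - (r - s) * L v\<bar> \<le> e' * n ((r - s) *\<^sub>R v)"
      using \<delta>(2)[of "x + r *\<^sub>R v"] x v unfolding eq scale by (simp add: add_mem scaleR_mem)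
    also have "\<dots> \<le> e' * (\<bar>r - s\<bar> * n v)" using le e'(1) by (intro mult_left_mono) auto
    also have "\<dots> = (e' * n v) * \<bar>r - s\<bar>" by simp
    also have "\<dots> \<le> e * \<bar>r - s\<bar>" using e'(2) by (intro mult_right_mono) auto
    finally show "norm (g (x + r *\<^sub>R v) - g (x + s *\<^sub>R v) - L v * (r - s)) \<le> e * norm (r - s)"
      by (simp add: mult.commute)
  qed
qed

text \<open>Identifies the derivative that \<open>C1_map_on\<close> merely asserts to exist with the
  one supplied by \<open>extended_derivative\<close>.\<close>

lemma frechet_derivative_unique:
  assumes "has_frechet_derivative E n UNIV abs E g L x" "has_frechet_derivative E n UNIV abs E g L' x"
    and "x \<in> E" "v \<in> E"
  shows "L v = L' v"
proof (rule DERIV_unique)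
  show "((\<lambda>s. g (x + s *\<^sub>R v)) has_real_derivative L v) (at 0)"
    by (rule frechet_derivative_along_line) (use assms in simp_all)
  show "((\<lambda>s. g (x + s *\<^sub>R v)) has_real_derivative L' v) (at 0)"
    by (rule frechet_derivative_along_line) (use assms in simp_all)
qed

end

section \<open>Perturbing the identity along a curve\<close>

text \<open>The Lipschitz bounds are with respect to the weaker norm of the ambient type, differentiability
  is with respect to \<open>n\<close>: a curve in \<open>C1_space h\<close> can be short in the sup norm although its
  derivatives at 0 are large.\<close>

locale curve_perturbation = normed_carrier E n
  for E :: "'a::real_normed_vector set" and n :: "'a \<Rightarrow> real" +
  fixes U :: "'a set" and G :: "'a \<Rightarrow> real" and DG :: "'a \<Rightarrow> 'a \<Rightarrow> real"
    and H :: "real \<Rightarrow> 'a" and \<eta> :: "real \<Rightarrow> 'a" and L c :: real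
  assumes open_U: "openin (norm_topology E n) U"
    and linear_DG: "x \<in> U \<Longrightarrow> linear_within E UNIV (DG x)"
    and DG_le: "x \<in> U \<Longrightarrow> v \<in> E \<Longrightarrow> \<bar>DG x v\<bar> \<le> L * norm v"
    and deriv_G: "x \<in> U \<Longrightarrow> e > 0 \<Longrightarrow>
      \<forall>\<^sub>F y in nbhd U x. \<bar>G y - G x - DG x (y - x)\<bar> \<le> e * n (y - x)"
    and cont_DG: "x \<in> U \<Longrightarrow> e > 0 \<Longrightarrow> \<forall>\<^sub>F y in nbhd U x. \<forall>v\<in>E. \<bar>DG y v - DG x v\<bar> \<le> e * n v"
    and G_lipschitz: "x \<in> U \<Longrightarrow> y \<in> U \<Longrightarrow> \<bar>G x - G y\<bar> \<le> L * norm (x - y)"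
    and H_mem: "H s \<in> E" and \<eta>_mem: "\<eta> s \<in> E"
    and norm_\<eta>: "norm (\<eta> s) \<le> c"
    and H_lipschitz: "norm (H s - H r) \<le> c * \<bar>s - r\<bar>"
    and deriv_H: "e > 0 \<Longrightarrow> \<forall>\<^sub>F r in nhds s. n (H r - H s - (r - s) *\<^sub>R \<eta> s) \<le> e * \<bar>r - s\<bar>"
    and cont_\<eta>: "((\<lambda>r. n (\<eta> r - \<eta> s)) \<longlongrightarrow> 0) (nhds s)"
    and L_nonneg: "0 \<le> L" and L_c: "L * c \<le> 1/2"
begin

section \<open>The perturbed identity, its derivative and the inverse of the derivative\<close>

definition \<Phi> :: "'a \<Rightarrow> 'a" where "\<Phi> x = x - H (G x)"

definition D\<Phi> :: "'a \<Rightarrow> 'a \<Rightarrow> 'a" where "D\<Phi> x v = v - DG x v *\<^sub>R \<eta> (G x)"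

text \<open>The Sherman-Morrison formula for \<open>D\<Phi> x\<close>, a rank-one perturbation of
  the identity.\<close>

definition D\<Phi>_inv :: "'a \<Rightarrow> 'a \<Rightarrow> 'a" where
  "D\<Phi>_inv x v = v + (DG x v / (1 - DG x (\<eta> (G x)))) *\<^sub>R \<eta> (G x)"

text \<open>A bound for \<open>D\<Phi>_inv x\<close> with respect to \<open>n\<close>. The factor 2
  bounds the reciprocal of \<open>1 - DG x (\<eta> (G x))\<close>.\<close>

definition bound_inv :: "'a \<Rightarrow> real" where "bound_inv x = 1 + 2 * L * n (\<eta> (G x))"

lemma U_subset: "U \<subseteq> E"
  using open_U by (simp add: openin_iff)

lemmas mem_E = subsetD[OF U_subset]

lemma DG_add: "x \<in> U \<Longrightarrow> v \<in> E \<Longrightarrow> w \<in> E \<Longrightarrow> DG x (v + w) = DG x v + DG x w"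
  and DG_scaleR: "x \<in> U \<Longrightarrow> v \<in> E \<Longrightarrow> DG x (r *\<^sub>R v) = r * DG x v"
  using linear_DG[of x] by (auto simp: linear_within_def)

lemma DG_diff: "x \<in> U \<Longrightarrow> v \<in> E \<Longrightarrow> w \<in> E \<Longrightarrow> DG x (v - w) = DG x v - DG x w"
  using DG_add[of x v "(-1) *\<^sub>R w"] DG_scaleR[of x w "-1"] scaleR_mem[of w "-1"] by simp

lemma DG_le_n: "x \<in> U \<Longrightarrow> v \<in> E \<Longrightarrow> \<bar>DG x v\<bar> \<le> L * n v"
  using DG_le[of x v] mult_left_mono[OF norm_le_n L_nonneg, of v] by linarith

text \<open>Both factors of \<open>L * c\<close> are bounds in the ambient norm, so this holds
  however large \<open>n (\<eta> s)\<close> is. It keeps the denominator in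
  \<open>D\<Phi>_inv\<close> at least 1/2.\<close>

lemma DG_\<eta>: assumes "x \<in> U" shows "DG x (\<eta> s) \<le> 1/2"
  using DG_le[OF assms \<eta>_mem[of s]] mult_left_mono[OF norm_\<eta>[of s] L_nonneg] L_c by linarith

lemma \<Phi>_mem: "x \<in> U \<Longrightarrow> \<Phi> x \<in> E"
  unfolding \<Phi>_def by (intro diff_mem mem_E H_mem)

lemma D\<Phi>_mem: "v \<in> E \<Longrightarrow> D\<Phi> x v \<in> E"
  unfolding D\<Phi>_def by (intro diff_mem scaleR_mem \<eta>_mem)

lemma D\<Phi>_inv_mem: "v \<in> E \<Longrightarrow> D\<Phi>_inv x v \<in> E"
  unfolding D\<Phi>_inv_def by (intro add_mem scaleR_mem \<eta>_mem)

text \<open>With \<open>k = 1 - DG x (\<eta> (G x))\<close>, linearity gives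
  \<open>DG x (D\<Phi> x v) = k * DG x v\<close>, and division by \<open>k\<close> recovers the
  coefficient that \<open>D\<Phi>\<close> subtracted.\<close>

lemma D\<Phi>_inverse:
  assumes "x \<in> U" "v \<in> E"
  shows "D\<Phi> x (D\<Phi>_inv x v) = v" "D\<Phi>_inv x (D\<Phi> x v) = v"
proof -
  have k: "1 - DG x (\<eta> (G x)) \<noteq> 0" using DG_\<eta>[OF assms(1), of "G x"] by simp
  show "D\<Phi> x (D\<Phi>_inv x v) = v" "D\<Phi>_inv x (D\<Phi> x v) = v"
    using assms k unfolding D\<Phi>_def D\<Phi>_inv_def
    by (simp_all add: DG_add DG_diff DG_scaleR scaleR_mem \<eta>_mem
        scaleR_add_left[symmetric] scaleR_diff_left[symmetric] field_simps)
qed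

lemma linear_D\<Phi>: "x \<in> U \<Longrightarrow> linear_within E E (D\<Phi> x)"
  unfolding linear_within_def
  by (auto simp: D\<Phi>_mem) (simp_all add: D\<Phi>_def DG_add DG_scaleR algebra_simps)

lemma linear_D\<Phi>_inv: "x \<in> U \<Longrightarrow> linear_within E E (D\<Phi>_inv x)"
  unfolding linear_within_def
  by (auto simp: D\<Phi>_inv_mem) (simp_all add: D\<Phi>_inv_def DG_add DG_scaleR algebra_simps add_divide_distrib)

lemma D\<Phi>_inv_diff:
  assumes "x \<in> U" "v \<in> E" "w \<in> E"
  shows "D\<Phi>_inv x (v - w) = D\<Phi>_inv x v - D\<Phi>_inv x w"
  using assms by (simp add: D\<Phi>_inv_def DG_diff algebra_simps diff_divide_distrib)

lemma n_D\<Phi>_le: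
  assumes "x \<in> U" "v \<in> E" shows "n (D\<Phi> x v) \<le> (1 + L * n (\<eta> (G x))) * n v"
proof -
  have "n (D\<Phi> x v) \<le> n v + \<bar>DG x v\<bar> * n (\<eta> (G x))"
    unfolding D\<Phi>_def using n_diff[OF assms(2) scaleR_mem[OF \<eta>_mem]] n_scaleR[OF \<eta>_mem]
    by (rule order_trans[OF _ add_left_mono])
  also have "\<dots> \<le> n v + L * n v * n (\<eta> (G x))"
    using assms by (intro add_left_mono mult_right_mono DG_le_n n_nonneg)
  finally show ?thesis by (simp add: algebra_simps)
qed

lemma n_D\<Phi>_inv_le:
  assumes "x \<in> U" "v \<in> E" shows "n (D\<Phi>_inv x v) \<le> bound_inv x * n v"
proof -
  let ?k = "1 - DG x (\<eta> (G x))"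
  have k: "?k \<ge> 1/2" using DG_\<eta>[OF assms(1), of "G x"] by simp
  have "n (D\<Phi>_inv x v) \<le> n v + \<bar>DG x v / ?k\<bar> * n (\<eta> (G x))"
    unfolding D\<Phi>_inv_def using n_add[OF assms(2) scaleR_mem[OF \<eta>_mem]] n_scaleR[OF \<eta>_mem]
    by (rule order_trans[OF _ add_left_mono])
  also have "\<dots> \<le> n v + (2 * (L * n v)) * n (\<eta> (G x))"
  proof (intro add_left_mono mult_right_mono n_nonneg)
    have "\<bar>DG x v / ?k\<bar> \<le> \<bar>DG x v\<bar> / (1/2)"
      unfolding abs_divide using k by (intro divide_left_mono) auto
    then show "\<bar>DG x v / ?k\<bar> \<le> 2 * (L * n v)" using DG_le_n[OF assms] by simp
  qed
  finally show ?thesis by (simp add: bound_inv_def algebra_simps)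
qed

lemma G_tendsto: assumes "x \<in> U" shows "(G \<longlongrightarrow> G x) (nbhd U x)"
proof (rule Lim_null_comparison[THEN LIM_zero_cancel])
  show "((\<lambda>y. L * n (y - x)) \<longlongrightarrow> 0) (nbhd U x)"
    by (rule tendsto_mult_right_zero[OF tendsto_nbhd])
  show "\<forall>\<^sub>F y in nbhd U x. norm (G y - G x) \<le> L * n (y - x)"
    using eventually_nbhd_mem[of U x]
  proof eventually_elim
    case (elim y)
    then show ?case
      using G_lipschitz[OF elim assms] mult_left_mono[OF norm_le_n L_nonneg, of "y - x"] assms
        diff_mem mem_E by fastforce
  qed
qed

lemma \<eta>_G_tendsto: assumes "x \<in> U" shows "((\<lambda>y. n (\<eta> (G y) - \<eta> (G x))) \<longlongrightarrow> 0) (nbhd U x)"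
  using filterlim_compose[OF cont_\<eta> G_tendsto[OF assms]] .

lemma deriv_\<Phi>:
  assumes x: "x \<in> U" and e: "e > 0"
  shows "\<forall>\<^sub>F y in nbhd U x. n (\<Phi> y - \<Phi> x - D\<Phi> x (y - x)) \<le> e * n (y - x)"
proof -
  let ?m = "n (\<eta> (G x))"
  \<comment> \<open>Each of the two error terms below receives \<open>e/2\<close>; the added 1
    avoids division by zero.\<close>
  define e1 where "e1 = e / (2 * (L + 1))"
  define e2 where "e2 = e / (2 * (?m + 1))"
  have p: "e1 > 0" "e2 > 0" "e1 * L \<le> e/2" "e2 * ?m \<le> e/2"
    using e L_nonneg n_nonneg[of "\<eta> (G x)"] by (auto simp: e1_def e2_def field_simps)
  have "\<forall>\<^sub>F y in nbhd U x. n (H (G y) - H (G x) - (G y - G x) *\<^sub>R \<eta> (G x)) \<le> e1 * \<bar>G y - G x\<bar>"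
    using filterlim_iff[THEN iffD1, OF G_tendsto[OF x]] deriv_H[OF p(1)] by blast
  then show ?thesis using deriv_G[OF x p(2)] eventually_nbhd_mem[of U x]
  proof eventually_elim
    case (elim y)
    let ?v = "y - x"
    have v: "?v \<in> E" using elim(3) x by (intro diff_mem mem_E)
    let ?R1 = "H (G y) - H (G x) - (G y - G x) *\<^sub>R \<eta> (G x)"
    let ?r = "G y - G x - DG x ?v"
    \<comment> \<open>Chain rule: the error is the remainder of \<open>H\<close> at
      \<open>G x\<close> plus the remainder of \<open>G\<close> carried along
      \<open>\<eta> (G x)\<close>.\<close>
    have "\<Phi> y - \<Phi> x - D\<Phi> x ?v = - (?R1 + ?r *\<^sub>R \<eta> (G x))"
      unfolding \<Phi>_def D\<Phi>_def by (simp add: algebra_simps)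
    then have "n (\<Phi> y - \<Phi> x - D\<Phi> x ?v) = n (?R1 + ?r *\<^sub>R \<eta> (G x))"
      using n_minus by metis
    also have "\<dots> \<le> n ?R1 + \<bar>?r\<bar> * ?m"
      using n_add[of ?R1 "?r *\<^sub>R \<eta> (G x)"] n_scaleR[OF \<eta>_mem, of ?r "G x"]
      by (smt (verit) H_mem \<eta>_mem diff_mem scaleR_mem)
    also have "\<dots> \<le> e1 * (L * n ?v) + e2 * n ?v * ?m"
    proof (rule add_mono)
      have "\<bar>G y - G x\<bar> \<le> L * n ?v"
        using G_lipschitz[OF elim(3) x] mult_left_mono[OF norm_le_n[OF v] L_nonneg] by linarith
      then show "n ?R1 \<le> e1 * (L * n ?v)"
        using elim(1) p(1) by (meson mult_left_mono order_trans less_imp_le)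
      show "\<bar>?r\<bar> * ?m \<le> e2 * n ?v * ?m"
        using elim(2) by (intro mult_right_mono n_nonneg)
    qed
    also have "\<dots> = (e1 * L + e2 * ?m) * n ?v" by (simp add: algebra_simps)
    also have "\<dots> \<le> e * n ?v" using p by (intro mult_right_mono n_nonneg) linarith
    finally show ?case .
  qed
qed

lemma cont_D\<Phi>:
  assumes x: "x \<in> U" and e: "e > 0"
  shows "\<forall>\<^sub>F y in nbhd U x. \<forall>v\<in>E. n (D\<Phi> y v - D\<Phi> x v) \<le> e * n v"
proof -
  let ?m = "n (\<eta> (G x))"
  define e1 where "e1 = e / (2 * (L + 1))"
  define e2 where "e2 = e / (2 * (?m + 1))"
  have p: "e1 > 0" "e2 > 0" "e1 * L \<le> e/2" "e2 * ?m \<le> e/2"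
    using e L_nonneg n_nonneg[of "\<eta> (G x)"] by (auto simp: e1_def e2_def field_simps)
  show ?thesis
    using order_tendstoD(2)[OF \<eta>_G_tendsto[OF x] p(1)] cont_DG[OF x p(2)] eventually_nbhd_mem[of U x]
  proof eventually_elim
    case (elim y)
    show ?case
    proof
      fix v assume v: "v \<in> E"
      let ?d = "\<eta> (G y) - \<eta> (G x)"
      have d: "?d \<in> E" by (intro diff_mem \<eta>_mem)
      have "D\<Phi> y v - D\<Phi> x v = - (DG y v *\<^sub>R ?d + (DG y v - DG x v) *\<^sub>R \<eta> (G x))"
        by (simp add: D\<Phi>_def algebra_simps)
      then have "n (D\<Phi> y v - D\<Phi> x v) = n (DG y v *\<^sub>R ?d + (DG y v - DG x v) *\<^sub>R \<eta> (G x))"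
        using n_minus by metis
      also have "\<dots> \<le> \<bar>DG y v\<bar> * n ?d + \<bar>DG y v - DG x v\<bar> * ?m"
        using n_add[OF scaleR_mem[OF d] scaleR_mem[OF \<eta>_mem]] n_scaleR[OF d] n_scaleR[OF \<eta>_mem]
        by (smt (verit))
      also have "\<dots> \<le> (L * n v) * e1 + (e2 * n v) * ?m"
        using elim v L_nonneg p(2) by (intro add_mono mult_mono DG_le_n mult_nonneg_nonneg n_nonneg) auto
      also have "\<dots> = (e1 * L + e2 * ?m) * n v" by (simp add: algebra_simps)
      also have "\<dots> \<le> e * n v" using p by (intro mult_right_mono n_nonneg) linarith
      finally show "n (D\<Phi> y v - D\<Phi> x v) \<le> e * n v" .
    qed
  qed
qed

section \<open>Injectivity and openness of the image\<close>

text \<open>Since \<open>x - y\<close> is \<open>\<Phi> x - \<Phi> y\<close> plus a difference of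
  values of \<open>H\<close>, the Lipschitz bound of \<open>G\<close> reproduces
  \<open>\<bar>G x - G y\<bar>\<close> on the right with factor \<open>L * c \<le> 1/2\<close>,
  where it can be absorbed. The scalar \<open>G x\<close> is thus controlled by
  \<open>\<Phi> x\<close> alone.\<close>

lemma G_le_\<Phi>:
  assumes "x \<in> U" "y \<in> U" shows "\<bar>G x - G y\<bar> \<le> 2 * L * norm (\<Phi> x - \<Phi> y)"
proof -
  have "x - y = (\<Phi> x - \<Phi> y) + (H (G x) - H (G y))" by (simp add: \<Phi>_def)
  then have "norm (x - y) \<le> norm (\<Phi> x - \<Phi> y) + c * \<bar>G x - G y\<bar>"
    using norm_triangle_ineq[of "\<Phi> x - \<Phi> y" "H (G x) - H (G y)"] H_lipschitz[of "G x" "G y"] by simp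
  then have "\<bar>G x - G y\<bar> \<le> L * (norm (\<Phi> x - \<Phi> y) + c * \<bar>G x - G y\<bar>)"
    using G_lipschitz[OF assms] mult_left_mono[OF _ L_nonneg] by (meson order_trans)
  also have "\<dots> = L * norm (\<Phi> x - \<Phi> y) + L * c * \<bar>G x - G y\<bar>" by (simp add: algebra_simps)
  also have "\<dots> \<le> L * norm (\<Phi> x - \<Phi> y) + 1/2 * \<bar>G x - G y\<bar>"
    using L_c by (intro add_left_mono mult_right_mono) auto
  finally show ?thesis by simp
qed

lemma inj_on_\<Phi>: "inj_on \<Phi> U"
proof (rule inj_onI)
  fix x y assume "x \<in> U" "y \<in> U" "\<Phi> x = \<Phi> y"
  \<comment> \<open>Equal images give \<open>G x = G y\<close>, so the same vector was subtracted
    from \<open>x\<close> and \<open>y\<close>.\<close>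
  then show "x = y" using G_le_\<Phi>[of x y] by (simp add: \<Phi>_def)
qed

text \<open>The global bound \<open>H_lipschitz\<close> is in the ambient norm. For
  \<open>n\<close>, differentiability with error 1 gives a bound at each point, with a constant
  depending on the point.\<close>

lemma H_tendsto: "((\<lambda>r. n (H r - H s)) \<longlongrightarrow> 0) (nhds s)"
  and H_lipschitz_at: "\<forall>\<^sub>F r in nhds s. n (H r - H s) \<le> (n (\<eta> s) + 1) * \<bar>r - s\<bar>"
proof -
  show *: "\<forall>\<^sub>F r in nhds s. n (H r - H s) \<le> (n (\<eta> s) + 1) * \<bar>r - s\<bar>"
    using deriv_H[of 1 s, OF zero_less_one]
  proof eventually_elim
    case (elim r)
    have "H r - H s = (H r - H s - (r - s) *\<^sub>R \<eta> s) + (r - s) *\<^sub>R \<eta> s" by simp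
    then have "n (H r - H s) \<le> n (H r - H s - (r - s) *\<^sub>R \<eta> s) + n ((r - s) *\<^sub>R \<eta> s)"
      by (metis n_add diff_mem H_mem \<eta>_mem scaleR_mem)
    then show ?case
      using elim n_scaleR[OF \<eta>_mem, of "r - s" s] by (simp add: algebra_simps)
  qed
  have "((\<lambda>r. (n (\<eta> s) + 1) * \<bar>r - s\<bar>) \<longlongrightarrow> (n (\<eta> s) + 1) * \<bar>s - s\<bar>) (nhds s)"
    by (intro tendsto_intros filterlim_ident)
  then show "((\<lambda>r. n (H r - H s)) \<longlongrightarrow> 0) (nhds s)"
    using * n_nonneg by (intro Lim_null_comparison[of "\<lambda>r. n (H r - H s)" "\<lambda>r. (n (\<eta> s) + 1) * \<bar>r - s\<bar>"]) auto
qed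

text \<open>For \<open>q\<close> near \<open>p = \<Phi> x\<close> a preimage is sought as
  \<open>q + H s\<close> with \<open>s = G (q + H s)\<close>. The unknown is a real number, so the
  intermediate value theorem on an interval around \<open>G x\<close> solves the equation and no
  limit in \<open>E\<close> is taken.\<close>

lemma open_image_\<Phi>: "openin (norm_topology E n) (\<Phi> ` U)"
  unfolding openin_iff
proof (intro conjI ballI)
  show "\<Phi> ` U \<subseteq> E" using \<Phi>_mem by blast
  fix p assume "p \<in> \<Phi> ` U"
  then obtain x where x: "x \<in> U" and p: "p = \<Phi> x" by blast
  obtain r where r: "r > 0" "\<And>y. y \<in> E \<Longrightarrow> n (y - x) < r \<Longrightarrow> y \<in> U"
    using open_U x by (auto simp: openin_iff)
  have "\<forall>\<^sub>F s in nhds (G x). n (H s - H (G x)) < r/2"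
    using H_tendsto r(1) by (intro order_tendstoD(2)) auto
  then obtain \<delta>' where "\<delta>' > 0" and \<delta>': "\<And>s. dist s (G x) < \<delta>' \<Longrightarrow> n (H s - H (G x)) < r/2"
    unfolding eventually_nhds_metric by blast
  \<comment> \<open>Halving makes the estimate available on the closed interval, end points
    included.\<close>
  define \<delta> where "\<delta> = \<delta>'/2"
  have \<delta>: "\<delta> > 0" "\<And>s. \<bar>s - G x\<bar> \<le> \<delta> \<Longrightarrow> n (H s - H (G x)) < r/2"
    using \<open>\<delta>' > 0\<close> \<delta>' by (auto simp: \<delta>_def dist_real_def)
  \<comment> \<open>The bound \<open>r/2\<close> leaves the other half of \<open>r\<close> to the
    displacement along \<open>H\<close>, so that \<open>q + H s\<close> stays in \<open>U\<close>;
    the second bound makes the defect of the equation at \<open>s = G x\<close> at most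
    \<open>\<delta>/2\<close>.\<close>
  define \<rho> where "\<rho> = min (r/2) (\<delta> / (2 * (L + 1)))"
  have \<rho>: "\<rho> > 0" "\<rho> \<le> r/2" "L * \<rho> \<le> \<delta>/2"
  proof -
    show "\<rho> > 0" using r(1) \<delta>(1) L_nonneg by (auto simp: \<rho>_def)
    show "\<rho> \<le> r/2" unfolding \<rho>_def by (rule min.cobounded1)
    have "L * \<rho> \<le> L * (\<delta> / (2 * (L + 1)))" using L_nonneg by (intro mult_left_mono) (auto simp: \<rho>_def)
    also have "\<dots> \<le> \<delta>/2" using L_nonneg \<delta>(1) by (simp add: field_simps)
    finally show "L * \<rho> \<le> \<delta>/2" .
  qed
  have "q \<in> \<Phi> ` U" if q: "q \<in> E" "n (q - p) < \<rho>" for q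
  proof -
    have U: "q + H s \<in> U" if "\<bar>s - G x\<bar> \<le> \<delta>" for s
    proof (rule r(2))
      show "q + H s \<in> E" by (intro add_mem q H_mem)
      have "q + H s - x = (q - p) + (H s - H (G x))" by (simp add: p \<Phi>_def)
      then have "n (q + H s - x) \<le> n (q - p) + n (H s - H (G x))"
        using x q by (metis n_add diff_mem H_mem \<Phi>_mem p)
      then show "n (q + H s - x) < r" using q(2) \<rho>(2) \<delta>(2)[OF that] by linarith
    qed
    let ?g = "\<lambda>s. s - G (q + H s)"
    have lip: "\<bar>G (q + H s) - G (q + H t)\<bar> \<le> 1/2 * \<bar>s - t\<bar>"
      if "\<bar>s - G x\<bar> \<le> \<delta>" "\<bar>t - G x\<bar> \<le> \<delta>" for s t
    proof -
      have "\<bar>G (q + H s) - G (q + H t)\<bar> \<le> L * (c * \<bar>s - t\<bar>)"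
        using G_lipschitz[OF U[OF that(1)] U[OF that(2)]] mult_left_mono[OF H_lipschitz[of s t] L_nonneg]
        by simp
      also have "\<dots> = (L * c) * \<bar>s - t\<bar>" by simp
      also have "\<dots> \<le> 1/2 * \<bar>s - t\<bar>" using L_c by (intro mult_right_mono) auto
      finally show ?thesis .
    qed
    have at: "\<bar>G (q + H (G x)) - G x\<bar> \<le> \<delta>/2"
    proof -
      have "\<bar>G (q + H (G x)) - G x\<bar> \<le> L * norm (q - p)"
        using G_lipschitz[OF U[of "G x"] x] \<delta>(1) by (simp add: p \<Phi>_def algebra_simps)
      also have "\<dots> \<le> L * \<rho>"
        using norm_le_n[of "q - p"] q \<Phi>_mem[OF x] p L_nonneg
        by (intro mult_left_mono) (auto simp: diff_mem intro: order_trans less_imp_le)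
      finally show ?thesis using \<rho>(3) by simp
    qed
    have "\<exists>s. G x - \<delta> \<le> s \<and> s \<le> G x + \<delta> \<and> ?g s = 0"
    proof (rule IVT')
      have "\<bar>G (q + H (G x - \<delta>)) - G (q + H (G x))\<bar> \<le> \<delta>/2"
        "\<bar>G (q + H (G x + \<delta>)) - G (q + H (G x))\<bar> \<le> \<delta>/2"
        using lip[of "G x - \<delta>" "G x"] lip[of "G x + \<delta>" "G x"] \<delta>(1) by simp_all
      \<comment> \<open>From the centre to either end \<open>G (q + H s)\<close> moves by at most
        \<open>\<delta>/2\<close>, and its value at the centre is within \<open>\<delta>/2\<close>
        of \<open>G x\<close>.\<close>
      then show "?g (G x - \<delta>) \<le> 0" "0 \<le> ?g (G x + \<delta>)"
        using at by linarith+
      show "G x - \<delta> \<le> G x + \<delta>" using \<delta>(1) by simp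
      have "(1/2)-lipschitz_on {G x - \<delta>..G x + \<delta>} (\<lambda>s. G (q + H s))"
        using lip by (intro lipschitz_onI) (auto simp: dist_real_def)
      then show "continuous_on {G x - \<delta>..G x + \<delta>} ?g"
        by (intro continuous_intros lipschitz_on_continuous_on)
    qed
    then obtain s where "G x - \<delta> \<le> s" "s \<le> G x + \<delta>" "?g s = 0" by blast
    then have s: "\<bar>s - G x\<bar> \<le> \<delta>" "G (q + H s) = s" by (simp_all add: abs_le_iff)
    then have "\<Phi> (q + H s) = q" by (simp add: \<Phi>_def)
    then show ?thesis using U[OF s(1)] by (metis imageI)
  qed
  then show "\<exists>r>0. \<forall>y\<in>E. n (y - p) < r \<longrightarrow> y \<in> \<Phi> ` U" using \<rho>(1) by blast
qed

section \<open>Smoothness of the inverse map\<close>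

abbreviation \<Psi> :: "'a \<Rightarrow> 'a" where "\<Psi> \<equiv> inv_into U \<Phi>"

lemma \<Psi>: "q \<in> \<Phi> ` U \<Longrightarrow> \<Psi> q \<in> U" "q \<in> \<Phi> ` U \<Longrightarrow> \<Phi> (\<Psi> q) = q" "x \<in> U \<Longrightarrow> \<Psi> (\<Phi> x) = x"
  using inj_on_\<Phi> by (auto simp: inv_into_into f_inv_into_f)

text \<open>By \<open>G_le_\<Phi>\<close>, \<open>G (\<Psi> q)\<close> is Lipschitz in
  \<open>q\<close> with constant \<open>2 * L\<close>; \<open>H_lipschitz_at\<close> then carries
  this over to \<open>n\<close>, because \<Psi> q is \<open>q + H (G (\<Psi> q))\<close>.\<close>

lemma \<Psi>_lipschitz_at:
  assumes x: "x \<in> U"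
  shows "\<forall>\<^sub>F q in nbhd (\<Phi> ` U) (\<Phi> x).
    n (\<Psi> q - x) \<le> (1 + (n (\<eta> (G x)) + 1) * (2 * L)) * n (q - \<Phi> x)"
proof -
  let ?m = "n (\<eta> (G x)) + 1"
  let ?N = "nbhd (\<Phi> ` U) (\<Phi> x)"
  have G: "\<bar>G (\<Psi> q) - G x\<bar> \<le> 2 * L * n (q - \<Phi> x)" if "q \<in> \<Phi> ` U" for q
  proof -
    have "q - \<Phi> x \<in> E" using that x by (auto intro: diff_mem \<Phi>_mem)
    then have "2 * L * norm (q - \<Phi> x) \<le> 2 * L * n (q - \<Phi> x)"
      using L_nonneg by (intro mult_left_mono norm_le_n) auto
    then show ?thesis using G_le_\<Phi>[OF \<Psi>(1)[OF that] x] \<Psi>(2)[OF that] by simp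
  qed
  have "((\<lambda>q. G (\<Psi> q)) \<longlongrightarrow> G x) ?N"
  proof (rule Lim_null_comparison[THEN LIM_zero_cancel])
    show "((\<lambda>q. 2 * L * n (q - \<Phi> x)) \<longlongrightarrow> 0) ?N"
      by (rule tendsto_mult_right_zero[OF tendsto_nbhd])
    show "\<forall>\<^sub>F q in ?N. norm (G (\<Psi> q) - G x) \<le> 2 * L * n (q - \<Phi> x)"
      using eventually_nbhd_mem[of "\<Phi> ` U" "\<Phi> x"] by eventually_elim (use G in auto)
  qed
  then have "\<forall>\<^sub>F q in ?N. n (H (G (\<Psi> q)) - H (G x)) \<le> ?m * \<bar>G (\<Psi> q) - G x\<bar>"
    using H_lipschitz_at[of "G x"] by (auto simp: filterlim_iff)
  then show ?thesis using eventually_nbhd_mem[of "\<Phi> ` U" "\<Phi> x"]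
  proof eventually_elim
    case (elim q)
    have "\<Psi> q - x = (q - \<Phi> x) + (H (G (\<Psi> q)) - H (G x))"
      using \<Psi>(2)[OF elim(2)] unfolding \<Phi>_def by (simp add: algebra_simps)
    then have "n (\<Psi> q - x) \<le> n (q - \<Phi> x) + n (H (G (\<Psi> q)) - H (G x))"
      using elim(2) x by (metis n_add diff_mem H_mem \<Phi>_mem imageE)
    also have "\<dots> \<le> n (q - \<Phi> x) + ?m * (2 * L * n (q - \<Phi> x))"
      using elim(1) mult_left_mono[OF G[OF elim(2)], of ?m] n_nonneg[of "\<eta> (G x)"] by linarith
    finally show ?case by (simp add: algebra_simps)
  qed
qed

text \<open>Pulls eventual statements about points near \<open>x\<close> back to points near
  \<open>\<Phi> x\<close> in the image.\<close>

lemma \<Psi>_filterlim: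
  assumes x: "x \<in> U"
  shows "filterlim \<Psi> (nbhd U x) (nbhd (\<Phi> ` U) (\<Phi> x))"
  unfolding nbhd_def[of U]
proof (intro filterlim_inf[THEN iffD2] conjI)
  let ?N = "nbhd (\<Phi> ` U) (\<Phi> x)"
  show "filterlim \<Psi> (principal U) ?N"
    unfolding filterlim_principal using eventually_nbhd_mem by eventually_elim (rule \<Psi>(1))
  have "((\<lambda>q. n (\<Psi> q - x)) \<longlongrightarrow> 0) ?N"
    by (rule Lim_null_comparison[OF _ tendsto_mult_right_zero[OF tendsto_nbhd]])
      (use \<Psi>_lipschitz_at[OF x] n_nonneg in simp)
  then show "filterlim \<Psi> (filtercomap (\<lambda>y. n (y - x)) (nhds 0)) ?N"
    by (simp add: filterlim_filtercomap_iff comp_def)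
qed

text \<open>The error for \<Psi> is, up to sign, \<open>D\<Phi>_inv x\<close> applied to the error
  for \<Phi> at \<open>\<Psi> q\<close>; \<open>\<Psi>_lipschitz_at\<close> converts
  \<open>n (\<Psi> q - x)\<close> into \<open>n (q - \<Phi> x)\<close>.\<close>

lemma deriv_\<Psi>:
  assumes x: "x \<in> U" and e: "e > 0"
  shows "\<forall>\<^sub>F q in nbhd (\<Phi> ` U) (\<Phi> x). n (\<Psi> q - x - D\<Phi>_inv x (q - \<Phi> x)) \<le> e * n (q - \<Phi> x)"
proof -
  let ?C = "1 + (n (\<eta> (G x)) + 1) * (2 * L)"
  have C: "?C > 0" using L_nonneg n_nonneg[of "\<eta> (G x)"] by (simp add: add_pos_nonneg)
  have B: "bound_inv x > 0" using L_nonneg n_nonneg[of "\<eta> (G x)"] by (simp add: bound_inv_def add_pos_nonneg)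
  define e1 where "e1 = e / (bound_inv x * ?C)"
  have e1: "e1 > 0" using e B C by (simp add: e1_def)
  have "\<forall>\<^sub>F q in nbhd (\<Phi> ` U) (\<Phi> x).
      n (\<Phi> (\<Psi> q) - \<Phi> x - D\<Phi> x (\<Psi> q - x)) \<le> e1 * n (\<Psi> q - x)"
    using deriv_\<Phi>[OF x e1] \<Psi>_filterlim[OF x] by (auto simp: filterlim_iff)
  then show ?thesis using \<Psi>_lipschitz_at[OF x] eventually_nbhd_mem[of "\<Phi> ` U" "\<Phi> x"]
  proof eventually_elim
    case (elim q)
    let ?v = "\<Psi> q - x" and ?w = "q - \<Phi> x"
    have v: "?v \<in> E" and w: "?w \<in> E"
      using elim(3) x mem_E[OF \<Psi>(1)] by (auto intro!: diff_mem \<Phi>_mem intro: mem_E)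
    have "?v - D\<Phi>_inv x ?w = - D\<Phi>_inv x (?w - D\<Phi> x ?v)"
      using D\<Phi>_inverse(2)[OF x v] D\<Phi>_inv_diff[OF x w D\<Phi>_mem[OF v]] by simp
    then have "n (?v - D\<Phi>_inv x ?w) \<le> bound_inv x * n (?w - D\<Phi> x ?v)"
      using n_D\<Phi>_inv_le[OF x diff_mem[OF w D\<Phi>_mem[OF v]]] by (simp add: n_minus)
    also have "\<dots> \<le> bound_inv x * (e1 * (?C * n ?w))"
    proof (rule mult_left_mono)
      have "e1 * n ?v \<le> e1 * (?C * n ?w)" using elim(2) e1 by (intro mult_left_mono) auto
      then show "n (?w - D\<Phi> x ?v) \<le> e1 * (?C * n ?w)" using elim(1) \<Psi>(2)[OF elim(3)] by simp
    qed (use B in simp)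
    also have "\<dots> = e * n ?w" using B C by (simp add: e1_def)
    finally show ?case .
  qed
qed

text \<open>The resolvent identity: for invertible \<open>A\<close>, \<open>B\<close>, the
  difference of the inverses of \<open>B\<close> and \<open>A\<close> is the inverse of
  \<open>B\<close>, times \<open>A - B\<close>, times the inverse of \<open>A\<close>. The base
  point stays in \<open>U\<close>; composition with \<Psi> comes later.\<close>

lemma cont_D\<Psi>:
  assumes x: "x \<in> U" and e: "e > 0"
  shows "\<forall>\<^sub>F y in nbhd U x. \<forall>v\<in>E. n (D\<Phi>_inv y v - D\<Phi>_inv x v) \<le> e * n v"
proof -
  have B: "bound_inv y > 0" for y
    using L_nonneg n_nonneg[of "\<eta> (G y)"] by (simp add: bound_inv_def add_pos_nonneg)
  \<comment> \<open>A bound for \<open>bound_inv y\<close> valid for all \<open>y\<close> near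
    \<open>x\<close>, where \<open>n (\<eta> (G y))\<close> exceeds \<open>n (\<eta> (G x))\<close>
    by at most 1.\<close>
  define M where "M = bound_inv x + 2 * L"
  have M: "M > 0" using B[of x] L_nonneg by (simp add: M_def)
  define e1 where "e1 = e / (M * bound_inv x)"
  have e1: "e1 > 0" using e B[of x] M by (simp add: e1_def)
  show ?thesis
    using order_tendstoD(2)[OF \<eta>_G_tendsto[OF x] zero_less_one] cont_D\<Phi>[OF x e1] eventually_nbhd_mem[of U x]
  proof eventually_elim
    case (elim y)
    have "n (\<eta> (G y)) \<le> n (\<eta> (G x)) + n (\<eta> (G y) - \<eta> (G x))"
      using n_add[OF \<eta>_mem diff_mem[OF \<eta>_mem \<eta>_mem], of "G x" "G y" "G x"] by simp
    also have "\<dots> \<le> n (\<eta> (G x)) + 1" using elim(1) by simp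
    finally have BM: "bound_inv y \<le> M"
      unfolding bound_inv_def M_def using mult_left_mono[of _ _ "2 * L"] L_nonneg by (force simp: distrib_left)
    show ?case
    proof
      fix v assume v: "v \<in> E"
      let ?u = "D\<Phi>_inv x v"
      have u: "?u \<in> E" using v by (rule D\<Phi>_inv_mem)
      have "D\<Phi>_inv y v - ?u = D\<Phi>_inv y (D\<Phi> x ?u - D\<Phi> y ?u)"
        using D\<Phi>_inverse(1)[OF x v] D\<Phi>_inverse(2)[OF elim(3) u]
          D\<Phi>_inv_diff[OF elim(3) v D\<Phi>_mem[OF u], of y] by simp
      then have "n (D\<Phi>_inv y v - ?u) \<le> bound_inv y * n (D\<Phi> y ?u - D\<Phi> x ?u)"
        using n_D\<Phi>_inv_le[OF elim(3) diff_mem[OF D\<Phi>_mem[OF u] D\<Phi>_mem[OF u]]] n_commute by metis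
      also have "\<dots> \<le> M * (e1 * (bound_inv x * n v))"
      proof (intro mult_mono BM n_nonneg)
        show "n (D\<Phi> y ?u - D\<Phi> x ?u) \<le> e1 * (bound_inv x * n v)"
          using elim(2) u mult_left_mono[OF n_D\<Phi>_inv_le[OF x v], of e1] e1
          by (meson less_imp_le order_trans)
      qed (use M in simp)
      also have "\<dots> = e * n v" using B[of x] M by (simp add: e1_def)
      finally show "n (D\<Phi>_inv y v - ?u) \<le> e * n v" .
    qed
  qed
qed

theorem diffeomorphism_\<Phi>: "diffeomorphism_on E n E n U (\<Phi> ` U) \<Phi>"
  unfolding diffeomorphism_on_def
proof (intro conjI open_U open_image_\<Phi>)
  show "bij_betw \<Phi> U (\<Phi> ` U)" using inj_on_\<Phi> by (simp add: bij_betw_def)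
  show "C1_map_on E n E n U \<Phi>"
  proof (rule C1_map_onI[where D = D\<Phi>])
    fix x assume "x \<in> U"
    then show "bounded_linear_within E n E n (D\<Phi> x)"
      unfolding bounded_linear_within_def using linear_D\<Phi> n_D\<Phi>_le by blast
  qed (use open_U \<Phi>_mem deriv_\<Phi> cont_D\<Phi> in auto)
  show "C1_map_on E n E n (\<Phi> ` U) \<Psi>"
  proof (rule C1_map_onI[where D = "\<lambda>q. D\<Phi>_inv (\<Psi> q)"])
    show "\<Psi> \<in> \<Phi> ` U \<rightarrow> E" using \<Psi>(1) mem_E by blast
    fix q assume q: "q \<in> \<Phi> ` U"
    note x = \<Psi>(1)[OF q] and \<Phi>x = \<Psi>(2)[OF q]
    show "bounded_linear_within E n E n (D\<Phi>_inv (\<Psi> q))"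
      unfolding bounded_linear_within_def using linear_D\<Phi>_inv[OF x] n_D\<Phi>_inv_le[OF x] by blast
    fix e :: real assume e: "e > 0"
    show "\<forall>\<^sub>F y in nbhd (\<Phi> ` U) q. n (\<Psi> y - \<Psi> q - D\<Phi>_inv (\<Psi> q) (y - q)) \<le> e * n (y - q)"
      using deriv_\<Psi>[OF x e] unfolding \<Phi>x .
    show "\<forall>\<^sub>F y in nbhd (\<Phi> ` U) q. \<forall>v\<in>E. n (D\<Phi>_inv (\<Psi> y) v - D\<Phi>_inv (\<Psi> q) v) \<le> e * n v"
      using \<Psi>_filterlim[OF x] cont_D\<Psi>[OF x e] unfolding \<Phi>x by (auto simp: filterlim_iff)
  qed (rule open_image_\<Phi>)
qed

end

section \<open>The curve in the space of continuously differentiable functions\<close>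

text \<open>The value 0 of \<open>C1_norm\<close> off the carrier gives the two locale axioms
  without membership premises.\<close>

lemma normed_carrier_C1:
  assumes "0 < h" shows "normed_carrier (C1_space h) (C1_norm h)"
proof
  interpret M: Metric_space "C1_space h" "\<lambda>\<phi> \<psi>. C1_norm h (\<phi> - \<psi>)"
    by (rule Metric_space_C1[OF assms])
  fix \<phi> show "0 \<le> C1_norm h \<phi>" using M.nonneg[of \<phi> 0] by simp
qed (use assms in \<open>auto simp: subspace_C1_space C1_norm_minus C1_norm_scaleR_le C1_norm_triangle C1_norm_ge_norm\<close>)

text \<open>Makes \<open>le_op_norm\<close> available for functionals on
  \<open>C_space h\<close>.\<close>

lemma normed_carrier_C: "normed_carrier (C_space h) norm"
  by unfold_locales (auto simp: subspace_C_space norm_triangle_ineq)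

lemma norm_C_space_le:
  assumes "0 \<le> h" "\<phi> \<in> C_space h" "\<And>t. t \<in> {-h..0} \<Longrightarrow> \<bar>apply_bcontfun \<phi> t\<bar> \<le> A"
  shows "norm \<phi> \<le> A"
  unfolding norm_C_space[OF assms(1,2)] using assms by (intro cSUP_least) auto

lemma C1_norm_le:
  assumes "0 < h" "\<phi> \<in> C1_space h"
    and "\<And>t. t \<in> {-h..0} \<Longrightarrow> \<bar>apply_bcontfun \<phi> t\<bar> \<le> A"
    and "\<And>t. t \<in> {-h..0} \<Longrightarrow> \<bar>seg_deriv h \<phi> t\<bar> \<le> B"
  shows "C1_norm h \<phi> \<le> A + B"
proof -
  have "norm \<phi> \<le> A" using assms by (intro norm_C_space_le[of h]) (auto simp: C1_space_def)
  moreover have "(SUP t\<in>{-h..0}. \<bar>seg_deriv h \<phi> t\<bar>) \<le> B" using assms by (intro cSUP_least) auto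
  ultimately show ?thesis using assms(2) by (simp add: C1_norm_def)
qed

lemma abs_seg_deriv_le:
  assumes "0 < h" "\<phi> \<in> C1_space h" "t \<in> {-h..0}"
  shows "\<bar>seg_deriv h \<phi> t\<bar> \<le> C1_norm h \<phi>"
proof -
  have "\<bar>seg_deriv h \<phi> t\<bar> \<le> (SUP t\<in>{-h..0}. \<bar>seg_deriv h \<phi> t\<bar>)"
    using assms by (intro cSUP_upper bdd_above_seg_deriv)
  then show ?thesis using assms(2) by (simp add: C1_norm_def add_increasing)
qed

lemma seg_deriv_diff:
  assumes "0 < h" "\<phi> \<in> C1_space h" "\<psi> \<in> C1_space h" "t \<in> {-h..0}"
  shows "seg_deriv h (\<phi> - \<psi>) t = seg_deriv h \<phi> t - seg_deriv h \<psi> t"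
  using C1_add_scaleR(2)[OF assms, of 1 "-1"] by simp

lemma seg_deriv_scaleR:
  assumes "0 < h" "\<phi> \<in> C1_space h" "t \<in> {-h..0}"
  shows "seg_deriv h (r *\<^sub>R \<phi>) t = r * seg_deriv h \<phi> t"
  using C1_add_scaleR(2)[OF assms(1,2,2,3), of r 0] by simp

lemma ex_C1_space:
  assumes "0 < h" "continuous_on {-h..0} g'"
    and "\<And>t. t \<in> {-h..0} \<Longrightarrow> (g has_real_derivative g' t) (at t within {-h..0})"
  shows "\<exists>\<phi>\<in>C1_space h. \<forall>t\<in>{-h..0}. apply_bcontfun \<phi> t = g t \<and> seg_deriv h \<phi> t = g' t"
proof -
  have "continuous_on {-h..0} g" using assms(3) by (rule DERIV_continuous_on)
  then obtain \<phi> where \<phi>: "\<phi> \<in> C_space h" "\<And>t. t \<in> {-h..0} \<Longrightarrow> apply_bcontfun \<phi> t = g t"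
    using ex1_C_space[of h g] assms(1) by auto
  have d: "(apply_bcontfun \<phi> has_real_derivative g' t) (at t within {-h..0})" if "t \<in> {-h..0}" for t
    using assms(3)[OF that] by (rule has_field_derivative_transform_within[where d=1]) (use that \<phi> in auto)
  then have "\<phi> \<in> C1_space h" using \<phi>(1) assms(2) by (auto simp: C1_space_def)
  then show ?thesis using \<phi>(2) seg_deriv_eqI[OF assms(1) _ d] by blast
qed

section \<open>Mean value estimates\<close>

text \<open>The mean value inequality after subtracting a linear function of slope \<open>m\<close>:
  \<open>m = 0\<close> gives Lipschitz bounds, a value of the derivative gives first-order
  remainders.\<close>

lemma C1_space_mean_value:
  assumes "0 < h" "\<phi> \<in> C1_space h" "-h \<le> s" "s \<le> t" "t \<le> 0"
    and "\<And>r. r \<in> {s..t} \<Longrightarrow> \<bar>seg_deriv h \<phi> r - m\<bar> \<le> B"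
  shows "\<bar>apply_bcontfun \<phi> t - apply_bcontfun \<phi> s - m * (t - s)\<bar> \<le> B * \<bar>t - s\<bar>"
proof -
  let ?g = "\<lambda>r. apply_bcontfun \<phi> r - m * r"
  have "norm (?g t - ?g s) \<le> B * norm (t - s)"
  proof (rule field_differentiable_bound[where S = "{s..t}"])
    fix r assume r: "r \<in> {s..t}"
    then have "(apply_bcontfun \<phi> has_real_derivative seg_deriv h \<phi> r) (at r within {s..t})"
      using assms by (intro has_field_derivative_subset[OF C1_spaceD(2)]) auto
    then show "(?g has_real_derivative (seg_deriv h \<phi> r - m)) (at r within {s..t})"
      by (auto intro!: derivative_eq_intros)
  qed (use assms in auto)
  then show ?thesis by (simp add: algebra_simps)
qed

text \<open>The closed segment allows \<open>x\<close> and \<open>y\<close> in either order; the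
  parameter of the curve may lie on either side of 0.\<close>

lemma mean_value_segment:
  fixes F :: "real \<Rightarrow> real"
  assumes "\<And>u. u \<in> closed_segment x y \<Longrightarrow> (F has_real_derivative F' u) (at u)"
    and "\<And>u. u \<in> closed_segment x y \<Longrightarrow> \<bar>F' u - m\<bar> \<le> B"
  shows "\<bar>F y - F x - (y - x) * m\<bar> \<le> B * \<bar>y - x\<bar>"
proof -
  let ?g = "\<lambda>r. F r - r * m"
  have "norm (?g y - ?g x) \<le> B * norm (y - x)"
  proof (rule field_differentiable_bound[where S = "closed_segment x y"])
    fix r assume r: "r \<in> closed_segment x y"
    show "(?g has_real_derivative (F' r - m)) (at r within closed_segment x y)"
      by (rule has_field_derivative_at_within) (auto intro!: derivative_eq_intros assms(1)[OF r])
  qed (use assms in auto)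
  then show ?thesis by (simp add: algebra_simps)
qed

lemma ex_antiderivative:
  fixes g :: "real \<Rightarrow> real"
  assumes "continuous_on UNIV g"
  shows "\<exists>F. F 0 = 0 \<and> (\<forall>u. (F has_real_derivative g u) (at u))"
proof -
  obtain F where F: "\<And>u. (F has_real_derivative g u) (at u)"
    using einterval_antiderivative[of "-\<infinity>" "\<infinity>" g] assms
    by (auto simp: continuous_on_eq_continuous_at has_real_derivative_iff_has_vector_derivative)
  show ?thesis
    by (rule exI[of _ "\<lambda>u. F u - F 0"]) (auto intro!: derivative_eq_intros F)
qed

text \<open>Serves in place of differentiation under the integral sign: a quadratic remainder in
  \<open>t\<close> that is uniform in the integration variable survives integration.\<close>

lemma has_real_derivative_quadratic_remainder:
  fixes g :: "real \<Rightarrow> real"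
  assumes "\<And>t. t \<in> S \<Longrightarrow> \<bar>g t - g s - (t - s) * D\<bar> \<le> K * (t - s)\<^sup>2"
  shows "(g has_real_derivative D) (at s within S)"
  unfolding has_field_derivative_def has_derivative_within_alt
proof (intro conjI allI impI bounded_linear_mult_right)
  fix e :: real assume e: "e > 0"
  show "\<exists>\<delta>>0. \<forall>t\<in>S. norm (t - s) < \<delta> \<longrightarrow> norm (g t - g s - D * (t - s)) \<le> e * norm (t - s)"
  proof (intro exI[of _ "e / (\<bar>K\<bar> + 1)"] conjI ballI impI)
    show "0 < e / (\<bar>K\<bar> + 1)" using e by simp
    fix t assume t: "t \<in> S" "norm (t - s) < e / (\<bar>K\<bar> + 1)"
    have "\<bar>g t - g s - (t - s) * D\<bar> \<le> K * (t - s)\<^sup>2" using assms t(1) by blast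
    also have "\<dots> \<le> (\<bar>K\<bar> + 1) * (t - s)\<^sup>2" by (intro mult_right_mono) auto
    also have "\<dots> = ((\<bar>K\<bar> + 1) * \<bar>t - s\<bar>) * \<bar>t - s\<bar>" by (simp add: power2_eq_square)
    also have "\<dots> \<le> e * \<bar>t - s\<bar>" using t(2) by (intro mult_right_mono) (auto simp: field_simps)
    finally show "norm (g t - g s - D * (t - s)) \<le> e * norm (t - s)" by (simp add: mult.commute)
  qed
qed

lemma abs_sin_diff_le: "\<bar>sin x - sin y\<bar> \<le> \<bar>x - y\<bar>" for x y :: real
  using mean_value_segment[of y x sin cos 0 1] abs_cos_le_one by (auto intro: DERIV_sin)

lemma abs_cos_diff_le: "\<bar>cos x - cos y\<bar> \<le> \<bar>x - y\<bar>" for x y :: real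
  using mean_value_segment[of y x cos "\<lambda>x. - sin x" 0 1] abs_sin_le_one by (auto intro: DERIV_cos)

lemma abs_sin_remainder_le: "\<bar>sin x - sin y - (x - y) * cos y\<bar> \<le> (x - y)\<^sup>2" for x y :: real
proof -
  have "\<bar>cos u - cos y\<bar> \<le> \<bar>x - y\<bar>" if "u \<in> closed_segment y x" for u
    using abs_cos_diff_le[of u y] that by (auto simp: closed_segment_eq_real_ivl split: if_splits)
  then show ?thesis
    using mean_value_segment[of y x sin cos "cos y" "\<bar>x - y\<bar>"] DERIV_sin
    by (auto simp: power2_eq_square abs_mult[symmetric])
qed

text \<open>\<open>H s t = f 0 * t + P t s\<close> where \<open>P t\<close> is the antiderivative of \<open>u \<mapsto> c * sin (t * f' u / c)\<close>
  that vanishes at 0: the integrand is bounded by \<open>c\<close> however large \<open>f'\<close> is, and its derivative in \<open>t\<close>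
  at \<open>t = 0\<close> is \<open>f' u\<close>, which integrates to \<open>f s - f 0\<close>.\<close>

lemma ex_small_curve:
  fixes f a :: "real \<Rightarrow> real"
  assumes h: "h > 0" and c: "c > 0"
    and f: "\<And>u. (f has_real_derivative a u) (at u)" and a: "continuous_on UNIV a"
  shows "\<exists>H \<eta>. (\<forall>s. H s \<in> C1_space h \<and> \<eta> s \<in> C1_space h \<and> norm (\<eta> s) \<le> c \<and>
      seg_deriv h (H s) 0 = f s) \<and>
    (\<forall>s r. norm (H s - H r) \<le> c * \<bar>s - r\<bar>) \<and>
    (\<forall>s e. e > 0 \<longrightarrow> (\<forall>\<^sub>F r in nhds s. C1_norm h (H r - H s - (r - s) *\<^sub>R \<eta> s) \<le> e * \<bar>r - s\<bar>)) \<and>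
    (\<forall>s. ((\<lambda>r. C1_norm h (\<eta> r - \<eta> s)) \<longlongrightarrow> 0) (nhds s))"
proof -
  interpret normed_carrier "C1_space h" "C1_norm h" by (rule normed_carrier_C1[OF h])
  define p where "p t r = c * sin (t * r / c)" for t r :: real
  \<comment> \<open>The derivative of \<open>p\<close> in \<open>t\<close>. Since
    \<open>q 0 r = r\<close>, its antiderivative at \<open>t = 0\<close> recovers \<open>f\<close>
    up to a constant.\<close>
  define q where "q t r = r * cos (t * r / c)" for t r :: real
  have p_le: "\<bar>p t r\<bar> \<le> c" for t r
    using c abs_sin_le_one[of "t * r / c"] mult_left_mono[of "\<bar>sin (t * r / c)\<bar>" 1 c] by (simp add: p_def abs_mult)
  have p_diff: "\<bar>p t r - p t r'\<bar> \<le> h * \<bar>r - r'\<bar>" if "t \<in> {-h..0}" for t r r'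
  proof -
    have "\<bar>p t r - p t r'\<bar> = c * \<bar>sin (t * r / c) - sin (t * r' / c)\<bar>"
      using c by (simp add: p_def abs_mult right_diff_distrib[symmetric])
    also have "\<dots> \<le> c * \<bar>t * r / c - t * r' / c\<bar>"
      using c by (intro mult_left_mono abs_sin_diff_le) auto
    also have "\<dots> = \<bar>t\<bar> * \<bar>r - r'\<bar>"
      using c by (simp add: diff_divide_distrib[symmetric] right_diff_distrib[symmetric] abs_mult)
    also have "\<dots> \<le> h * \<bar>r - r'\<bar>" using that by (intro mult_right_mono) auto
    finally show ?thesis .
  qed
  \<comment> \<open>The constant depends on \<open>r'\<close> alone, which will be the fixed value
    \<open>a s\<close>, and not on the nearby value \<open>r\<close>.\<close>
  have q_diff: "\<bar>q t r - q t r'\<bar> \<le> (1 + \<bar>r'\<bar> * h / c) * \<bar>r - r'\<bar>" if "t \<in> {-h..0}" for t r r'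
  proof -
    have "q t r - q t r' = (r - r') * cos (t * r / c) + r' * (cos (t * r / c) - cos (t * r' / c))"
      by (simp add: q_def algebra_simps)
    then have "\<bar>q t r - q t r'\<bar> \<le> \<bar>r - r'\<bar> * \<bar>cos (t * r / c)\<bar> + \<bar>r'\<bar> * \<bar>cos (t * r / c) - cos (t * r' / c)\<bar>"
      by (metis abs_triangle_ineq abs_mult)
    also have "\<dots> \<le> \<bar>r - r'\<bar> * 1 + \<bar>r'\<bar> * (h * \<bar>r - r'\<bar> / c)"
    proof (intro add_mono mult_left_mono)
      have "\<bar>cos (t * r / c) - cos (t * r' / c)\<bar> \<le> \<bar>t * r / c - t * r' / c\<bar>" by (rule abs_cos_diff_le)
      also have "\<dots> = \<bar>t\<bar> * \<bar>r - r'\<bar> / c"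
        using c by (simp add: diff_divide_distrib[symmetric] right_diff_distrib[symmetric] abs_mult)
      also have "\<dots> \<le> h * \<bar>r - r'\<bar> / c"
        using that c by (intro divide_right_mono mult_right_mono) auto
      finally show "\<bar>cos (t * r / c) - cos (t * r' / c)\<bar> \<le> h * \<bar>r - r'\<bar> / c" .
    qed (auto simp: abs_cos_le_one)
    finally show ?thesis by (simp add: algebra_simps)
  qed
  have p_rem: "\<bar>p t r - p s r - (t - s) * q s r\<bar> \<le> r\<^sup>2 / c * (t - s)\<^sup>2" for t s r
  proof -
    have "p t r - p s r - (t - s) * q s r
        = c * (sin (t * r / c) - sin (s * r / c) - (t * r / c - s * r / c) * cos (s * r / c))"
      using c by (simp add: p_def q_def field_simps)
    also have "\<bar>\<dots>\<bar> \<le> c * (t * r / c - s * r / c)\<^sup>2"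
      unfolding abs_mult using c by (simp add: abs_sin_remainder_le)
    also have "\<dots> = r\<^sup>2 / c * (t - s)\<^sup>2"
      using c by (simp add: field_simps power2_eq_square)
    finally show ?thesis .
  qed
  have q_lip: "\<bar>q t r - q s r\<bar> \<le> r\<^sup>2 / c * \<bar>t - s\<bar>" for t s r
  proof -
    have "\<bar>q t r - q s r\<bar> = \<bar>r\<bar> * \<bar>cos (t * r / c) - cos (s * r / c)\<bar>"
      by (simp add: q_def abs_mult right_diff_distrib[symmetric])
    also have "\<dots> \<le> \<bar>r\<bar> * \<bar>t * r / c - s * r / c\<bar>"
      by (intro mult_left_mono abs_cos_diff_le) auto
    also have "\<dots> = \<bar>r\<bar> * (\<bar>r\<bar> / c * \<bar>t - s\<bar>)"
      using c by (simp add: diff_divide_distrib[symmetric] left_diff_distrib[symmetric] abs_mult)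
    also have "\<dots> = r\<^sup>2 / c * \<bar>t - s\<bar>" by (simp add: power2_eq_square)
    finally show ?thesis .
  qed
  have "\<exists>F. F 0 = 0 \<and> (\<forall>u. (F has_real_derivative p t (a u)) (at u))" for t
    unfolding p_def using c by (intro ex_antiderivative continuous_intros a) auto
  then obtain P where P0: "\<And>t. P t 0 = 0" and P: "\<And>t u. (P t has_real_derivative p t (a u)) (at u)"
    by metis
  have "\<exists>F. F 0 = 0 \<and> (\<forall>u. (F has_real_derivative q t (a u)) (at u))" for t
    unfolding q_def using c by (intro ex_antiderivative continuous_intros a) auto
  then obtain Q where Q0: "\<And>t. Q t 0 = 0" and Q: "\<And>t u. (Q t has_real_derivative q t (a u)) (at u)"
    by metis
  have ex_H: "\<exists>\<phi>. \<phi> \<in> C1_space h \<and> (\<forall>t\<in>{-h..0}. apply_bcontfun \<phi> t = f 0 * t + P t s \<and>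
      seg_deriv h \<phi> t = f 0 + Q t s)" for s
  proof -
    \<comment> \<open>Boundedness of \<open>a\<close> on the segment makes the remainder estimates
      in \<open>t\<close> uniform in \<open>u\<close>.\<close>
    have "bounded (a ` closed_segment 0 s)"
      by (intro compact_imp_bounded compact_continuous_image continuous_on_subset[OF a]) auto
    then obtain M where M: "\<And>u. u \<in> closed_segment 0 s \<Longrightarrow> \<bar>a u\<bar> \<le> M"
      by (auto simp: bounded_iff)
    have M2: "(a u)\<^sup>2 / c \<le> M\<^sup>2 / c" if "u \<in> closed_segment 0 s" for u
      using M[OF that] c by (intro divide_right_mono) (auto simp: abs_le_square_iff[symmetric])
    \<comment> \<open>The estimate \<open>p_rem\<close> integrated over \<open>u\<close> from 0 to
      \<open>s\<close>.\<close>
    have "\<bar>P t s - P t' s - (t - t') * Q t' s\<bar> \<le> \<bar>s\<bar> * (M\<^sup>2 / c) * (t - t')\<^sup>2" for t t'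
    proof -
      have "\<bar>(P t s - P t' s - (t - t') * Q t' s) - (P t 0 - P t' 0 - (t - t') * Q t' 0) - (s - 0) * 0\<bar>
          \<le> (M\<^sup>2 / c * (t - t')\<^sup>2) * \<bar>s - 0\<bar>"
      proof (rule mean_value_segment[where F' = "\<lambda>u. p t (a u) - p t' (a u) - (t - t') * q t' (a u)"])
        fix u assume u: "u \<in> closed_segment 0 s"
        show "((\<lambda>s. P t s - P t' s - (t - t') * Q t' s) has_real_derivative
            p t (a u) - p t' (a u) - (t - t') * q t' (a u)) (at u)"
          by (auto intro!: derivative_eq_intros P Q)
        show "\<bar>p t (a u) - p t' (a u) - (t - t') * q t' (a u) - 0\<bar> \<le> M\<^sup>2 / c * (t - t')\<^sup>2"
          using order_trans[OF p_rem mult_right_mono[OF M2[OF u]]] by simp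
      qed
      then show ?thesis by (simp add: P0 Q0 mult_ac)
    qed
    then have dP: "((\<lambda>t. P t s) has_real_derivative Q t s) (at t within {-h..0})" for t
      by (rule has_real_derivative_quadratic_remainder)
    have "\<bar>Q t s - Q t' s\<bar> \<le> \<bar>s\<bar> * (M\<^sup>2 / c) * \<bar>t - t'\<bar>" for t t'
    proof -
      have "\<bar>(Q t s - Q t' s) - (Q t 0 - Q t' 0) - (s - 0) * 0\<bar> \<le> (M\<^sup>2 / c * \<bar>t - t'\<bar>) * \<bar>s - 0\<bar>"
      proof (rule mean_value_segment[where F' = "\<lambda>u. q t (a u) - q t' (a u)"])
        fix u assume u: "u \<in> closed_segment 0 s"
        show "((\<lambda>s. Q t s - Q t' s) has_real_derivative q t (a u) - q t' (a u)) (at u)"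
          by (auto intro!: derivative_eq_intros Q)
        show "\<bar>q t (a u) - q t' (a u) - 0\<bar> \<le> M\<^sup>2 / c * \<bar>t - t'\<bar>"
          using order_trans[OF q_lip mult_right_mono[OF M2[OF u]]] by simp
      qed
      then show ?thesis by (simp add: Q0 mult_ac)
    qed
    then have "(\<bar>s\<bar> * (M\<^sup>2 / c))-lipschitz_on {-h..0} (\<lambda>t. Q t s)"
      using c by (intro lipschitz_onI) (auto simp: dist_real_def)
    then have "continuous_on {-h..0} (\<lambda>t. f 0 + Q t s)"
      by (intro continuous_intros lipschitz_on_continuous_on)
    moreover have "((\<lambda>t. f 0 * t + P t s) has_real_derivative f 0 + Q t s) (at t within {-h..0})" for t
      by (auto intro!: derivative_eq_intros dP)
    ultimately show ?thesis using ex_C1_space[OF h] by blast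
  qed
  obtain H where H: "\<And>s. H s \<in> C1_space h"
      "\<And>s t. t \<in> {-h..0} \<Longrightarrow> apply_bcontfun (H s) t = f 0 * t + P t s"
      "\<And>s t. t \<in> {-h..0} \<Longrightarrow> seg_deriv h (H s) t = f 0 + Q t s"
    using choice[of "\<lambda>s \<phi>. \<phi> \<in> C1_space h \<and> (\<forall>t\<in>{-h..0}. apply_bcontfun \<phi> t = f 0 * t + P t s \<and>
      seg_deriv h \<phi> t = f 0 + Q t s)"] ex_H by blast
  have ex_\<eta>: "\<exists>\<phi>. \<phi> \<in> C1_space h \<and> (\<forall>t\<in>{-h..0}. apply_bcontfun \<phi> t = p t (a s) \<and>
      seg_deriv h \<phi> t = q t (a s))" for s
  proof -
    have "continuous_on {-h..0} (\<lambda>t. q t (a s))"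
      unfolding q_def using c by (intro continuous_intros) auto
    moreover have "((\<lambda>t. p t (a s)) has_real_derivative q t (a s)) (at t within {-h..0})" for t
      unfolding p_def q_def using c by (auto intro!: derivative_eq_intros)
    ultimately show ?thesis using ex_C1_space[OF h] by blast
  qed
  obtain \<eta> where \<eta>: "\<And>s. \<eta> s \<in> C1_space h"
      "\<And>s t. t \<in> {-h..0} \<Longrightarrow> apply_bcontfun (\<eta> s) t = p t (a s)"
      "\<And>s t. t \<in> {-h..0} \<Longrightarrow> seg_deriv h (\<eta> s) t = q t (a s)"
    using choice[of "\<lambda>s \<phi>. \<phi> \<in> C1_space h \<and> (\<forall>t\<in>{-h..0}. apply_bcontfun \<phi> t = p t (a s) \<and>
      seg_deriv h \<phi> t = q t (a s))"] ex_\<eta> by blast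
  have C: "\<phi> \<in> C1_space h \<Longrightarrow> \<phi> \<in> C_space h" for \<phi> by (simp add: C1_space_def)
  have apply_diff: "apply_bcontfun (\<phi> - \<psi>) t = apply_bcontfun \<phi> t - apply_bcontfun \<psi> t" for \<phi> \<psi> :: "real \<Rightarrow>\<^sub>C real" and t
    by (simp add: minus_bcontfun.rep_eq)
  have norm_\<eta>: "norm (\<eta> s) \<le> c" for s
    using h by (intro norm_C_space_le[of h]) (auto simp: C \<eta> p_le)
  \<comment> \<open>The difference \<open>Q 0 s - f s\<close> has derivative
    \<open>q 0 (a s) - a s = 0\<close>.\<close>
  have f_eq: "f 0 + Q 0 s = f s" for s
  proof -
    have "\<bar>(Q 0 s - f s) - (Q 0 0 - f 0) - (s - 0) * 0\<bar> \<le> 0 * \<bar>s - 0\<bar>"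
      by (rule mean_value_segment[where F' = "\<lambda>u. q 0 (a u) - a u"])
        (auto intro!: derivative_eq_intros Q f simp: q_def)
    then show ?thesis by (simp add: Q0)
  qed
  have H_lip: "norm (H s - H r) \<le> c * \<bar>s - r\<bar>" for s r
  proof (rule norm_C_space_le[of h])
    show "H s - H r \<in> C_space h" by (intro C diff_mem H)
    fix t assume t: "t \<in> {-h..0}"
    \<comment> \<open>The term \<open>f 0 * t\<close> cancels in differences of \<open>H\<close>, so
      only the bound \<open>c\<close> for \<open>p\<close> enters.\<close>
    have "\<bar>P t s - P t r - (s - r) * 0\<bar> \<le> c * \<bar>s - r\<bar>"
      by (rule mean_value_segment[OF P]) (simp add: p_le)
    then show "\<bar>apply_bcontfun (H s - H r) t\<bar> \<le> c * \<bar>s - r\<bar>" using t by (simp add: apply_diff H)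
  qed (use h in simp)
  \<comment> \<open>The sum of the constants of \<open>p_diff\<close> and \<open>q_diff\<close> at
    \<open>r' = a s\<close>, one for the function and one for its derivative.\<close>
  define B where "B s = h + (1 + \<bar>a s\<bar> * h / c)" for s
  have B: "B s > 0" for s using h c by (simp add: B_def add_pos_nonneg)
  have a_tendsto: "(a \<longlongrightarrow> a s) (nhds s)" for s
    using a by (simp add: continuous_on_eq_continuous_at isCont_def tendsto_at_iff_tendsto_nhds)
  have deriv: "\<forall>\<^sub>F r in nhds s. C1_norm h (H r - H s - (r - s) *\<^sub>R \<eta> s) \<le> e * \<bar>r - s\<bar>" if e: "e > 0" for s e
  proof -
    have "\<forall>\<^sub>F u in nhds s. dist (a u) (a s) < e / B s"
      using a_tendsto e B by (intro tendstoD) auto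
    then obtain \<delta> where "\<delta> > 0" and \<delta>: "\<And>u. \<bar>u - s\<bar> < \<delta> \<Longrightarrow> \<bar>a u - a s\<bar> < e / B s"
      unfolding eventually_nhds_metric by (auto simp: dist_real_def)
    have "C1_norm h (H r - H s - (r - s) *\<^sub>R \<eta> s) \<le> e * \<bar>r - s\<bar>" if r: "\<bar>r - s\<bar> < \<delta>" for r
    proof -
      have au: "\<bar>a u - a s\<bar> \<le> e / B s" if "u \<in> closed_segment s r" for u
        using that r \<delta>[of u] by (auto simp: closed_segment_eq_real_ivl split: if_splits)
      have "C1_norm h (H r - H s - (r - s) *\<^sub>R \<eta> s)
          \<le> (h * (e / B s)) * \<bar>r - s\<bar> + ((1 + \<bar>a s\<bar> * h / c) * (e / B s)) * \<bar>r - s\<bar>"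
      proof (rule C1_norm_le[OF h])
        show "H r - H s - (r - s) *\<^sub>R \<eta> s \<in> C1_space h" by (intro diff_mem scaleR_mem H \<eta>)
        fix t assume t: "t \<in> {-h..0}"
        have "\<bar>P t r - P t s - (r - s) * p t (a s)\<bar> \<le> (h * (e / B s)) * \<bar>r - s\<bar>"
          by (rule mean_value_segment[OF P])
            (rule order_trans[OF p_diff[OF t] mult_left_mono[OF au]], use h in auto)
        then show "\<bar>apply_bcontfun (H r - H s - (r - s) *\<^sub>R \<eta> s) t\<bar> \<le> (h * (e / B s)) * \<bar>r - s\<bar>"
          using t by (simp add: apply_diff scaleR_bcontfun.rep_eq H \<eta>)
        have "\<bar>Q t r - Q t s - (r - s) * q t (a s)\<bar> \<le> ((1 + \<bar>a s\<bar> * h / c) * (e / B s)) * \<bar>r - s\<bar>"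
          by (rule mean_value_segment[OF Q])
            (rule order_trans[OF q_diff[OF t] mult_left_mono[OF au]], use h c in auto)
        then show "\<bar>seg_deriv h (H r - H s - (r - s) *\<^sub>R \<eta> s) t\<bar> \<le> ((1 + \<bar>a s\<bar> * h / c) * (e / B s)) * \<bar>r - s\<bar>"
          using t h by (simp add: seg_deriv_diff seg_deriv_scaleR diff_mem scaleR_mem H \<eta>)
      qed
      also have "\<dots> = (B s * (e / B s)) * \<bar>r - s\<bar>" unfolding B_def by (simp only: distrib_right)
      also have "\<dots> = e * \<bar>r - s\<bar>" using B[of s] by simp
      finally show ?thesis .
    qed
    then show ?thesis
      unfolding eventually_nhds_metric dist_real_def using \<open>\<delta> > 0\<close> by blast
  qed
  have cont: "((\<lambda>r. C1_norm h (\<eta> r - \<eta> s)) \<longlongrightarrow> 0) (nhds s)" for s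
  proof (rule Lim_null_comparison)
    have "C1_norm h (\<eta> r - \<eta> s) \<le> h * \<bar>a r - a s\<bar> + (1 + \<bar>a s\<bar> * h / c) * \<bar>a r - a s\<bar>" for r
      using p_diff q_diff
      by (intro C1_norm_le[OF h]) (auto simp: diff_mem \<eta> apply_diff seg_deriv_diff h)
    then show "\<forall>\<^sub>F r in nhds s. norm (C1_norm h (\<eta> r - \<eta> s)) \<le> B s * \<bar>a r - a s\<bar>"
      by (simp add: n_nonneg B_def distrib_right)
    have "((\<lambda>r. B s * \<bar>a r - a s\<bar>) \<longlongrightarrow> B s * \<bar>a s - a s\<bar>) (nhds s)"
      by (intro tendsto_intros a_tendsto)
    then show "((\<lambda>r. B s * \<bar>a r - a s\<bar>) \<longlongrightarrow> 0) (nhds s)" by simp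
  qed
  show ?thesis
    by (rule exI[of _ H], rule exI[of _ \<eta>])
      (use H(1) \<eta>(1) norm_\<eta> H(3) f_eq h H_lip deriv cont in auto)
qed

section \<open>Evaluation at the delay\<close>

locale delay =
  fixes h b K :: real and d :: "(real \<Rightarrow>\<^sub>C real) \<Rightarrow> real"
    and De :: "(real \<Rightarrow>\<^sub>C real) \<Rightarrow> (real \<Rightarrow>\<^sub>C real) \<Rightarrow> real"
  assumes h: "h > 0" and b: "b > 0"
    and d_range: "d \<in> C1_space h \<rightarrow> {-h<..<0}"
    and d_C1: "C1_map_on (C1_space h) (C1_norm h) UNIV abs (C1_space h) d"
    and De: "extended_derivative h d De"
    and K: "0 \<le> K" "\<And>\<phi>. \<phi> \<in> C1_space h \<Longrightarrow> \<bar>seg_deriv h \<phi> (-h)\<bar> < b \<Longrightarrow>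
      op_norm (C_space h) norm abs (De \<phi>) \<le> K"
begin

sublocale normed_carrier "C1_space h" "C1_norm h" by (rule normed_carrier_C1[OF h])

lemma d_mem: "\<phi> \<in> C1_space h \<Longrightarrow> d \<phi> \<in> {-h..0}" and d_gt: "\<phi> \<in> C1_space h \<Longrightarrow> -h < d \<phi>"
  using d_range by (force simp: Pi_iff)+

lemma C1_in_C: "\<phi> \<in> C1_space h \<Longrightarrow> \<phi> \<in> C_space h"
  by (simp add: C1_space_def)

lemma apply_diff: "apply_bcontfun (\<phi> - \<psi>) t = apply_bcontfun \<phi> t - apply_bcontfun \<psi> t"
  for \<phi> \<psi> :: "real \<Rightarrow>\<^sub>C real"
  by (simp add: minus_bcontfun.rep_eq)

lemma abs_apply_le: "\<bar>apply_bcontfun \<phi> t\<bar> \<le> norm \<phi>" for \<phi> :: "real \<Rightarrow>\<^sub>C real"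
  using norm_bounded[of \<phi> t] by simp

section \<open>The extended derivative of the delay\<close>

lemma De_frechet:
  "\<phi> \<in> C1_space h \<Longrightarrow> has_frechet_derivative (C1_space h) (C1_norm h) UNIV abs (C1_space h) d (De \<phi>) \<phi>"
  and linear_De: "\<phi> \<in> C1_space h \<Longrightarrow> linear_within (C_space h) UNIV (De \<phi>)"
  using De by (auto simp: extended_derivative_def)

lemma deriv_d:
  assumes "\<phi> \<in> C1_space h" "e > 0"
  shows "\<forall>\<^sub>F \<psi> in nbhd (C1_space h) \<phi>. \<bar>d \<psi> - d \<phi> - De \<phi> (\<psi> - \<phi>)\<bar> \<le> e * C1_norm h (\<psi> - \<phi>)"
  using De_frechet[OF assms(1)] assms(2) by (simp add: has_frechet_derivative_def eventually_nbhd)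

lemma De_bound:
  assumes "\<phi> \<in> C1_space h"
  shows "\<exists>M\<ge>0. \<forall>v\<in>C1_space h. \<bar>De \<phi> v\<bar> \<le> M * C1_norm h v"
proof -
  obtain M where M: "\<And>v. v \<in> C1_space h \<Longrightarrow> \<bar>De \<phi> v\<bar> \<le> M * C1_norm h v"
    using De_frechet[OF assms] by (auto simp: has_frechet_derivative_def bounded_linear_within_def)
  have "M * C1_norm h v \<le> \<bar>M\<bar> * C1_norm h v" for v by (intro mult_right_mono n_nonneg) auto
  with M show ?thesis by (intro exI[of _ "\<bar>M\<bar>"]) (auto intro: order_trans)
qed

text \<open>Joint continuity of \<open>De\<close> is weaker than continuity in operator norm. The
  latter comes from \<open>d_C1\<close>, whose derivative agrees with \<open>De\<close> on
  \<open>C1_space h\<close> by uniqueness.\<close>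

lemma cont_De:
  assumes \<phi>: "\<phi> \<in> C1_space h" and e: "e > 0"
  shows "\<forall>\<^sub>F \<psi> in nbhd (C1_space h) \<phi>. \<forall>v\<in>C1_space h. \<bar>De \<psi> v - De \<phi> v\<bar> \<le> e * C1_norm h v"
proof -
  obtain D where D: "\<And>\<phi>. \<phi> \<in> C1_space h \<Longrightarrow>
        has_frechet_derivative (C1_space h) (C1_norm h) UNIV abs (C1_space h) d (D \<phi>) \<phi>"
    and cont: "\<forall>\<^sub>F \<psi> in nbhd (C1_space h) \<phi>. op_norm (C1_space h) (C1_norm h) abs (\<lambda>v. D \<psi> v - D \<phi> v) < e"
    using d_C1 \<phi> e unfolding C1_map_on_def eventually_nbhd by blast
  have eq: "D \<psi> v = De \<psi> v" if "\<psi> \<in> C1_space h" "v \<in> C1_space h" for \<psi> v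
    using frechet_derivative_unique[OF D De_frechet] that by blast
  show ?thesis using cont eventually_nbhd_mem
  proof eventually_elim
    case (elim \<psi>)
    show ?case
    proof
      fix v assume v: "v \<in> C1_space h"
      obtain M1 where M1: "\<And>v. v \<in> C1_space h \<Longrightarrow> \<bar>De \<psi> v\<bar> \<le> M1 * C1_norm h v"
        using De_bound[OF elim(2)] by blast
      obtain M2 where M2: "\<And>v. v \<in> C1_space h \<Longrightarrow> \<bar>De \<phi> v\<bar> \<le> M2 * C1_norm h v"
        using De_bound[OF \<phi>] by blast
      have "\<bar>D \<psi> v - D \<phi> v\<bar> \<le> op_norm (C1_space h) (C1_norm h) abs (\<lambda>v. D \<psi> v - D \<phi> v) * C1_norm h v"
      proof (rule le_op_norm[where K = "M1 + M2"])
        show "linear_within (C1_space h) UNIV (\<lambda>v. D \<psi> v - D \<phi> v)"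
          using D[OF elim(2)] D[OF \<phi>]
          by (simp add: has_frechet_derivative_def bounded_linear_within_def linear_within_def algebra_simps)
        show "\<bar>D \<psi> w - D \<phi> w\<bar> \<le> (M1 + M2) * C1_norm h w" if "w \<in> C1_space h" for w
          using M1[OF that] M2[OF that] eq[OF elim(2) that] eq[OF \<phi> that] by (simp add: distrib_right)
      qed (rule v)
      also have "\<dots> \<le> e * C1_norm h v" using elim(1) by (intro mult_right_mono n_nonneg) auto
      finally show "\<bar>De \<psi> v - De \<phi> v\<bar> \<le> e * C1_norm h v" using eq elim(2) \<phi> v by simp
    qed
  qed
qed

text \<open>Continuity of \<open>De \<phi>\<close> on \<open>C_space h\<close> first gives some
  bound, which makes the supremum in \<open>op_norm\<close> genuine; only then does the hypothesis
  on \<open>op_norm\<close> turn into a pointwise estimate.\<close>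

lemma De_le:
  assumes \<phi>: "\<phi> \<in> C1_space h" "\<bar>seg_deriv h \<phi> (-h)\<bar> < b" and \<omega>: "\<omega> \<in> C_space h"
  shows "\<bar>De \<phi> \<omega>\<bar> \<le> K * norm \<omega>"
proof -
  interpret C: normed_carrier "C_space h" norm by (rule normed_carrier_C)
  interpret M: Metric_space "C1_space h" "\<lambda>x y. C1_norm h (x - y)" by (rule Metric_space)
  have lin: "De \<phi> (r *\<^sub>R x) = r * De \<phi> x" if "x \<in> C_space h" for r x
    using linear_De[OF \<phi>(1)] that by (simp add: linear_within_def)
  have "continuous_map (top_of_set (C_space h)) (prod_topology (C1_top h) (top_of_set (C_space h))) (\<lambda>x. (\<phi>, x))"
    using \<phi>(1) by (auto simp: continuous_map_pairedI C1_top_def norm_topology_def)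
  then have "continuous_map (top_of_set (C_space h)) euclideanreal (De \<phi>)"
    using De continuous_map_compose unfolding extended_derivative_def by (fastforce simp: comp_def)
  then have "continuous_on (C_space h) (De \<phi>)" by simp
  moreover have De_0: "De \<phi> 0 = 0" using lin[OF C.zero_mem, of 0] by simp
  ultimately have "\<exists>\<delta>>0. \<forall>x\<in>C_space h. dist x 0 < \<delta> \<longrightarrow> dist (De \<phi> x) (De \<phi> 0) < 1"
    using C.zero_mem unfolding continuous_on_iff by (meson zero_less_one)
  then obtain \<delta> where \<delta>: "\<delta> > 0" "\<And>x. x \<in> C_space h \<Longrightarrow> norm x < \<delta> \<Longrightarrow> \<bar>De \<phi> x\<bar> < 1"
    unfolding De_0 by auto
  have "\<bar>De \<phi> x\<bar> \<le> (2 / \<delta>) * norm x" if x: "x \<in> C_space h" for x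
  proof (cases "x = 0")
    case False
    \<comment> \<open>Scales \<open>x\<close> to norm \<open>\<delta>/2\<close>, safely inside the
      ball where \<open>De \<phi>\<close> is below 1.\<close>
    let ?r = "\<delta> / (2 * norm x)"
    have "\<bar>De \<phi> (?r *\<^sub>R x)\<bar> < 1"
      using \<delta>(1) False by (intro \<delta>(2) C.scaleR_mem x) auto
    then show ?thesis using lin[OF x] \<delta>(1) False by (simp add: abs_mult field_simps)
  qed (simp add: De_0)
  then have "\<bar>De \<phi> \<omega>\<bar> \<le> op_norm (C_space h) norm abs (De \<phi>) * norm \<omega>"
    by (rule C.le_op_norm[OF linear_De[OF \<phi>(1)] _ \<omega>])
  also have "\<dots> \<le> K * norm \<omega>" using K(2)[OF \<phi>] by (intro mult_right_mono) auto
  finally show ?thesis .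
qed

text \<open>The interval in the definition of \<open>U_set\<close> moves with \<open>d\<close>, so
  segments are not known to stay in it. The condition at \<open>-h\<close> alone does persist along
  segments, because the derivative at \<open>-h\<close> is affine there.\<close>

lemma d_lipschitz:
  assumes \<phi>: "\<phi> \<in> C1_space h" "\<bar>seg_deriv h \<phi> (-h)\<bar> < b"
    and \<psi>: "\<psi> \<in> C1_space h" "\<bar>seg_deriv h \<psi> (-h)\<bar> < b"
  shows "\<bar>d \<phi> - d \<psi>\<bar> \<le> K * norm (\<phi> - \<psi>)"
proof -
  let ?v = "\<phi> - \<psi>"
  have v: "?v \<in> C1_space h" by (intro diff_mem \<phi> \<psi>)
  have "norm (d (\<psi> + 1 *\<^sub>R ?v) - d (\<psi> + 0 *\<^sub>R ?v)) \<le> (K * norm ?v) * norm (1 - 0 :: real)"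
  proof (rule field_differentiable_bound[where S = "{0..1}"])
    fix s :: real assume s: "s \<in> {0..1}"
    have m: "\<psi> + s *\<^sub>R ?v \<in> C1_space h" by (intro add_mem scaleR_mem v \<psi>)
    show "((\<lambda>s. d (\<psi> + s *\<^sub>R ?v)) has_real_derivative De (\<psi> + s *\<^sub>R ?v) ?v) (at s within {0..1})"
      by (rule frechet_derivative_along_line[OF De_frechet[OF m] \<psi>(1) v])
    have "\<psi> + s *\<^sub>R ?v = (1 - s) *\<^sub>R \<psi> + s *\<^sub>R \<phi>" by (simp add: algebra_simps)
    then have "seg_deriv h (\<psi> + s *\<^sub>R ?v) (-h) = (1 - s) *\<^sub>R seg_deriv h \<psi> (-h) + s *\<^sub>R seg_deriv h \<phi> (-h)"
      using C1_add_scaleR(2)[OF h \<psi>(1) \<phi>(1), of "-h"] h by simp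
    also have "\<dots> \<in> {-b<..<b}"
      using \<phi>(2) \<psi>(2) s by (intro convexD convex_real_interval) auto
    finally have "\<bar>seg_deriv h (\<psi> + s *\<^sub>R ?v) (-h)\<bar> < b" by auto
    then show "norm (De (\<psi> + s *\<^sub>R ?v) ?v) \<le> K * norm ?v"
      using De_le[OF m _ C1_in_C[OF v]] by simp
  qed auto
  then show ?thesis by simp
qed

section \<open>Openness of the domain and calculus of the evaluation\<close>

abbreviation U where "U \<equiv> U_set h d b"

definition G where "G \<phi> = apply_bcontfun \<phi> (d \<phi>)"

text \<open>The derivative of \<phi> at a moving point, by the chain and product rules. The
  direction \<open>v\<close> enters through its values only, never through its derivative.\<close>

definition DG where "DG \<phi> v = seg_deriv h \<phi> (d \<phi>) * De \<phi> v + apply_bcontfun v (d \<phi>)"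

lemma U_D:
  assumes "\<phi> \<in> U"
  shows "\<phi> \<in> C1_space h" "\<bar>seg_deriv h \<phi> (-h)\<bar> < b" "t \<in> {-h..d \<phi>} \<Longrightarrow> \<bar>seg_deriv h \<phi> t\<bar> < b"
  using assms d_gt[of \<phi>] by (auto simp: U_set_def)

text \<open>A local bound in the C1 norm at an arbitrary point, for use in derivative estimates; the
  contraction rests on the sup norm bound \<open>d_lipschitz\<close> instead.\<close>

lemma d_lipschitz_at:
  assumes "\<phi> \<in> C1_space h"
  shows "\<exists>M\<ge>0. \<forall>\<^sub>F \<psi> in nbhd (C1_space h) \<phi>. \<bar>d \<psi> - d \<phi>\<bar> \<le> M * C1_norm h (\<psi> - \<phi>)"
proof -
  obtain M where M: "M \<ge> 0" "\<And>v. v \<in> C1_space h \<Longrightarrow> \<bar>De \<phi> v\<bar> \<le> M * C1_norm h v"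
    using De_bound[OF assms] by blast
  have "\<forall>\<^sub>F \<psi> in nbhd (C1_space h) \<phi>. \<bar>d \<psi> - d \<phi>\<bar> \<le> (M + 1) * C1_norm h (\<psi> - \<phi>)"
    using deriv_d[OF assms zero_less_one] eventually_nbhd_mem
  proof eventually_elim
    case (elim \<psi>)
    then show ?case using M(2)[OF diff_mem[OF elim(2) assms]] by (simp add: distrib_right)
  qed
  then show ?thesis using M(1) by (intro exI[of _ "M + 1"]) auto
qed

lemma d_tendsto:
  assumes "\<phi> \<in> C1_space h" shows "(d \<longlongrightarrow> d \<phi>) (nbhd (C1_space h) \<phi>)"
proof -
  obtain M where "\<forall>\<^sub>F \<psi> in nbhd (C1_space h) \<phi>. \<bar>d \<psi> - d \<phi>\<bar> \<le> M * C1_norm h (\<psi> - \<phi>)"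
    using d_lipschitz_at[OF assms] by blast
  then show ?thesis
    by (intro Lim_null_comparison[OF _ tendsto_mult_right_zero[OF tendsto_nbhd], THEN LIM_zero_cancel]) simp
qed

lemma seg_deriv_close:
  assumes "\<phi> \<in> C1_space h" "s \<in> {-h..0}" "e > 0"
  shows "\<exists>\<delta>>0. \<forall>t\<in>{-h..0}. \<bar>t - s\<bar> < \<delta> \<longrightarrow> \<bar>seg_deriv h \<phi> t - seg_deriv h \<phi> s\<bar> < e"
  using C1_spaceD(1)[OF h assms(1)] assms(2,3) by (simp add: continuous_on_iff dist_real_def)

text \<open>The interval on which the derivative is bounded varies with the function. Times slightly
  beyond \<open>d \<phi>\<close> are handled by continuity of \<phi>' at \<open>d \<phi>\<close>,
  all others by compactness.\<close>

lemma open_U: "openin (norm_topology (C1_space h) (C1_norm h)) U"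
  unfolding openin_iff
proof (intro conjI ballI)
  show "U \<subseteq> C1_space h" using U_D(1) by blast
  fix \<phi> assume \<phi>: "\<phi> \<in> U"
  note \<phi>C = U_D(1)[OF \<phi>]
  have ne: "{-h..d \<phi>} \<noteq> {}" using d_gt[OF \<phi>C] by simp
  have "continuous_on {-h..d \<phi>} (\<lambda>t. \<bar>seg_deriv h \<phi> t\<bar>)"
    using d_mem[OF \<phi>C] by (intro continuous_intros continuous_on_subset[OF C1_spaceD(1)[OF h \<phi>C]]) auto
  then obtain t0 where t0: "t0 \<in> {-h..d \<phi>}" "\<And>t. t \<in> {-h..d \<phi>} \<Longrightarrow> \<bar>seg_deriv h \<phi> t\<bar> \<le> \<bar>seg_deriv h \<phi> t0\<bar>"
    using continuous_attains_sup[OF compact_Icc ne] by blast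
  \<comment> \<open>Half the gap between \<open>b\<close> and the maximum: one \<open>e\<close> for
    passing beyond \<open>d \<phi>\<close>, one for replacing \<phi>' by \<psi>'.\<close>
  define e where "e = (b - \<bar>seg_deriv h \<phi> t0\<bar>) / 2"
  have e: "e > 0" and b_eq: "b = \<bar>seg_deriv h \<phi> t0\<bar> + 2 * e"
    using U_D(3)[OF \<phi> t0(1)] by (auto simp: e_def field_simps)
  obtain \<delta> where \<delta>: "\<delta> > 0" "\<And>t. t \<in> {-h..0} \<Longrightarrow> \<bar>t - d \<phi>\<bar> < \<delta> \<Longrightarrow> \<bar>seg_deriv h \<phi> t - seg_deriv h \<phi> (d \<phi>)\<bar> < e"
    using seg_deriv_close[OF \<phi>C d_mem[OF \<phi>C] e] by blast
  have "\<forall>\<^sub>F \<psi> in nbhd (C1_space h) \<phi>. \<psi> \<in> U"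
    using tendstoD[OF d_tendsto[OF \<phi>C] \<delta>(1)] order_tendstoD(2)[OF tendsto_nbhd e] eventually_nbhd_mem
  proof eventually_elim
    case (elim \<psi>)
    have "\<bar>seg_deriv h \<psi> t\<bar> < b" if t: "t \<in> {-h..d \<psi>}" for t
    proof -
      have t': "t \<in> {-h..0}" using t d_mem[OF elim(3)] by auto
      have "\<bar>seg_deriv h \<phi> t\<bar> < \<bar>seg_deriv h \<phi> t0\<bar> + e"
      proof (cases "t \<le> d \<phi>")
        case True
        then show ?thesis using t0(2)[of t] t' e by auto
      next
        case False
        then have "\<bar>t - d \<phi>\<bar> < \<delta>" using t elim(1) by (auto simp: dist_real_def)
        then show ?thesis using \<delta>(2)[OF t'] t0(2)[of "d \<phi>"] ne by auto
      qed
      moreover have "\<bar>seg_deriv h \<psi> t - seg_deriv h \<phi> t\<bar> < e"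
        using abs_seg_deriv_le[OF h diff_mem[OF elim(3) \<phi>C] t'] seg_deriv_diff[OF h elim(3) \<phi>C t'] elim(2) by simp
      moreover have "\<bar>seg_deriv h \<psi> t\<bar> \<le> \<bar>seg_deriv h \<psi> t - seg_deriv h \<phi> t\<bar> + \<bar>seg_deriv h \<phi> t\<bar>"
        by linarith
      ultimately show ?thesis using b_eq by linarith
    qed
    then show ?case using elim(3) by (simp add: U_set_def)
  qed
  then show "\<exists>r>0. \<forall>\<psi>\<in>C1_space h. C1_norm h (\<psi> - \<phi>) < r \<longrightarrow> \<psi> \<in> U"
    by (simp add: eventually_nbhd)
qed

lemma linear_DG:
  assumes "\<phi> \<in> C1_space h" shows "linear_within (C1_space h) UNIV (DG \<phi>)"
proof -
  have "De \<phi> (v + w) = De \<phi> v + De \<phi> w" "De \<phi> (r *\<^sub>R v) = r * De \<phi> v"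
    if "v \<in> C1_space h" "w \<in> C1_space h" for v w r
    using linear_De[OF assms] that[THEN C1_in_C] by (auto simp: linear_within_def)
  then show ?thesis
    by (auto simp: linear_within_def DG_def plus_bcontfun.rep_eq scaleR_bcontfun.rep_eq algebra_simps)
qed

lemma DG_le:
  assumes "\<phi> \<in> U" "v \<in> C1_space h" shows "\<bar>DG \<phi> v\<bar> \<le> (1 + b * K) * norm v"
proof -
  note \<phi> = U_D[OF assms(1)]
  have "\<bar>DG \<phi> v\<bar> \<le> \<bar>seg_deriv h \<phi> (d \<phi>)\<bar> * \<bar>De \<phi> v\<bar> + \<bar>apply_bcontfun v (d \<phi>)\<bar>"
    unfolding DG_def by (metis abs_triangle_ineq abs_mult)
  also have "\<dots> \<le> b * (K * norm v) + norm v"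
    using \<phi>(3)[of "d \<phi>"] d_mem[OF \<phi>(1)] De_le[OF \<phi>(1,2) C1_in_C[OF assms(2)]] b
    by (intro add_mono mult_mono abs_apply_le) auto
  finally show ?thesis by (simp add: algebra_simps)
qed

text \<open>The bound \<open>b\<close> for the derivative of \<open>\<psi>\<close> is available up to \<open>d \<psi>\<close> only, whence \<open>d \<phi> \<le> d \<psi>\<close>.\<close>

lemma G_lipschitz_aux:
  assumes "\<phi> \<in> U" "\<psi> \<in> U" "d \<phi> \<le> d \<psi>"
  shows "\<bar>G \<phi> - G \<psi>\<bar> \<le> (1 + b * K) * norm (\<phi> - \<psi>)"
proof -
  note \<phi> = U_D[OF assms(1)] and \<psi> = U_D[OF assms(2)]
  have "\<bar>apply_bcontfun \<psi> (d \<psi>) - apply_bcontfun \<psi> (d \<phi>) - 0 * (d \<psi> - d \<phi>)\<bar> \<le> b * \<bar>d \<psi> - d \<phi>\<bar>"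
    using assms(3) d_mem[OF \<phi>(1)] d_mem[OF \<psi>(1)] less_imp_le[OF \<psi>(3)]
    by (intro C1_space_mean_value[OF h \<psi>(1)]) auto
  also have "\<dots> \<le> b * (K * norm (\<phi> - \<psi>))"
    using d_lipschitz[OF \<phi>(1,2) \<psi>(1,2)] b by (intro mult_left_mono) auto
  finally have "\<bar>apply_bcontfun \<psi> (d \<phi>) - apply_bcontfun \<psi> (d \<psi>)\<bar> \<le> b * K * norm (\<phi> - \<psi>)" by simp
  moreover have "\<bar>apply_bcontfun \<phi> (d \<phi>) - apply_bcontfun \<psi> (d \<phi>)\<bar> \<le> norm (\<phi> - \<psi>)"
    using abs_apply_le[of "\<phi> - \<psi>" "d \<phi>"] by (simp add: apply_diff)
  ultimately show ?thesis unfolding G_def distrib_right by linarith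
qed

lemma G_lipschitz:
  assumes "\<phi> \<in> U" "\<psi> \<in> U" shows "\<bar>G \<phi> - G \<psi>\<bar> \<le> (1 + b * K) * norm (\<phi> - \<psi>)"
  using G_lipschitz_aux[OF assms] G_lipschitz_aux[OF assms(2,1)]
  by (metis abs_minus_commute linear norm_minus_commute)

text \<open>Three errors: the nonlinearity of \<phi> between the two delays, the nonlinearity of
  \<open>d\<close>, and the change of \<open>\<psi> - \<phi>\<close> between the two delays. The
  last is of second order because the derivative of \<open>\<psi> - \<phi>\<close> is itself
  small.\<close>

lemma deriv_G:
  assumes \<phi>: "\<phi> \<in> C1_space h" and e: "e > 0"
  shows "\<forall>\<^sub>F \<psi> in nbhd (C1_space h) \<phi>. \<bar>G \<psi> - G \<phi> - DG \<phi> (\<psi> - \<phi>)\<bar> \<le> e * C1_norm h (\<psi> - \<phi>)"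
proof -
  obtain M where M: "M \<ge> 0" "\<forall>\<^sub>F \<psi> in nbhd (C1_space h) \<phi>. \<bar>d \<psi> - d \<phi>\<bar> \<le> M * C1_norm h (\<psi> - \<phi>)"
    using d_lipschitz_at[OF \<phi>] by blast
  define e1 where "e1 = e / (3 * (M + 1))"
  define m where "m = \<bar>seg_deriv h \<phi> (d \<phi>)\<bar>"
  define e2 where "e2 = e / (3 * (m + 1))"
  have p: "e1 > 0" "e2 > 0" "e1 * M \<le> e/3" "m * e2 \<le> e/3"
    using e M(1) by (auto simp: e1_def e2_def m_def field_simps)
  obtain \<delta> where \<delta>: "\<delta> > 0" "\<And>t. t \<in> {-h..0} \<Longrightarrow> \<bar>t - d \<phi>\<bar> < \<delta> \<Longrightarrow> \<bar>seg_deriv h \<phi> t - seg_deriv h \<phi> (d \<phi>)\<bar> < e1"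
    using seg_deriv_close[OF \<phi> d_mem[OF \<phi>] p(1)] by blast
  show ?thesis
    using M(2) tendstoD[OF d_tendsto[OF \<phi>] \<delta>(1)] order_tendstoD(2)[OF tendsto_nbhd p(1)]
      deriv_d[OF \<phi> p(2)] eventually_nbhd_mem
  proof eventually_elim
    case (elim \<psi>)
    let ?v = "\<psi> - \<phi>"
    have v: "?v \<in> C1_space h" by (intro diff_mem elim \<phi>)
    \<comment> \<open>Either delay may be the later one; both cases reduce to
      \<open>C1_space_mean_value\<close>.\<close>
    have mv: "\<bar>apply_bcontfun \<omega> (d \<psi>) - apply_bcontfun \<omega> (d \<phi>) - m' * (d \<psi> - d \<phi>)\<bar> \<le> B * \<bar>d \<psi> - d \<phi>\<bar>"
      if "\<omega> \<in> C1_space h" "\<And>r. r \<in> {-h..0} \<Longrightarrow> \<bar>r - d \<phi>\<bar> < \<delta> \<Longrightarrow> \<bar>seg_deriv h \<omega> r - m'\<bar> \<le> B" for \<omega> m' B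
    proof (cases "d \<phi> \<le> d \<psi>")
      case True
      then show ?thesis
        using d_mem[OF \<phi>] d_mem[OF elim(5)] elim(2)
        by (intro C1_space_mean_value[OF h that(1)] that(2)) (auto simp: dist_real_def)
    next
      case False
      then have "\<bar>apply_bcontfun \<omega> (d \<phi>) - apply_bcontfun \<omega> (d \<psi>) - m' * (d \<phi> - d \<psi>)\<bar> \<le> B * \<bar>d \<phi> - d \<psi>\<bar>"
        using d_mem[OF \<phi>] d_mem[OF elim(5)] elim(2)
        by (intro C1_space_mean_value[OF h that(1)] that(2)) (auto simp: dist_real_def)
      then show ?thesis by (simp add: abs_minus_commute algebra_simps abs_if split: if_splits)
    qed
    let ?A = "apply_bcontfun \<phi> (d \<psi>) - apply_bcontfun \<phi> (d \<phi>) - seg_deriv h \<phi> (d \<phi>) * (d \<psi> - d \<phi>)"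
    let ?B = "seg_deriv h \<phi> (d \<phi>) * (d \<psi> - d \<phi> - De \<phi> ?v)"
    let ?C = "apply_bcontfun ?v (d \<psi>) - apply_bcontfun ?v (d \<phi>) - 0 * (d \<psi> - d \<phi>)"
    have A: "\<bar>?A\<bar> \<le> e1 * \<bar>d \<psi> - d \<phi>\<bar>"
      using \<delta>(2) by (intro mv \<phi>) (auto intro: less_imp_le)
    have C: "\<bar>?C\<bar> \<le> e1 * \<bar>d \<psi> - d \<phi>\<bar>"
      using abs_seg_deriv_le[OF h v] elim(3) by (intro mv v) fastforce
    have dd: "e1 * \<bar>d \<psi> - d \<phi>\<bar> \<le> e/3 * C1_norm h ?v"
    proof -
      have "e1 * \<bar>d \<psi> - d \<phi>\<bar> \<le> e1 * (M * C1_norm h ?v)" using elim(1) p(1) by (intro mult_left_mono) auto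
      also have "\<dots> = (e1 * M) * C1_norm h ?v" by simp
      also have "\<dots> \<le> e/3 * C1_norm h ?v" by (intro mult_right_mono p n_nonneg)
      finally show ?thesis .
    qed
    have B: "\<bar>?B\<bar> \<le> e/3 * C1_norm h ?v"
    proof -
      have "\<bar>?B\<bar> \<le> m * (e2 * C1_norm h ?v)"
        unfolding abs_mult m_def[symmetric] using elim(4) by (intro mult_left_mono) (auto simp: m_def)
      also have "\<dots> = (m * e2) * C1_norm h ?v" by simp
      also have "\<dots> \<le> e/3 * C1_norm h ?v" by (intro mult_right_mono p n_nonneg)
      finally show ?thesis .
    qed
    have "G \<psi> - G \<phi> - DG \<phi> ?v = ?A + ?B + ?C"
      unfolding G_def DG_def by (simp add: apply_diff algebra_simps)
    then show ?case using A B C dd by linarith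
  qed
qed

text \<open>The C1 norm of \<open>v\<close> is essential here: evaluations at two different times
  are close as functionals only when the derivative of \<open>v\<close> is controlled.\<close>

lemma cont_DG:
  assumes \<phi>: "\<phi> \<in> C1_space h" and e: "e > 0"
  shows "\<forall>\<^sub>F \<psi> in nbhd (C1_space h) \<phi>. \<forall>v\<in>C1_space h. \<bar>DG \<psi> v - DG \<phi> v\<bar> \<le> e * C1_norm h v"
proof -
  obtain M where M: "M \<ge> 0" "\<And>v. v \<in> C1_space h \<Longrightarrow> \<bar>De \<phi> v\<bar> \<le> M * C1_norm h v"
    using De_bound[OF \<phi>] by blast
  \<comment> \<open>Bounds \<psi>' at \<open>d \<psi>\<close> for all nearby \<psi>: that value
    differs from \<phi>' at \<open>d \<phi>\<close> by at most \<open>2 * e1\<close>, and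
    \<open>e1 \<le> 1\<close>.\<close>
  define m where "m = \<bar>seg_deriv h \<phi> (d \<phi>)\<bar> + 2"
  define e1 where "e1 = min 1 (e / (6 * (M + 1)))"
  define e2 where "e2 = e / (3 * m)"
  have p: "e1 > 0" "2 * e1 * M \<le> e/3" "e1 \<le> 1" "e2 > 0" "m * e2 \<le> e/3" "m \<ge> 1"
  proof -
    show "m \<ge> 1" by (simp add: m_def)
    then show "e2 > 0" "m * e2 \<le> e/3" using e by (auto simp: e2_def)
    show "e1 > 0" "e1 \<le> 1" using e M(1) by (auto simp: e1_def)
    have "2 * e1 * M \<le> 2 * (e / (6 * (M + 1))) * M"
      using M(1) by (intro mult_right_mono mult_left_mono) (auto simp: e1_def)
    also have "\<dots> \<le> e/3" using e M(1) by (simp add: field_simps)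
    finally show "2 * e1 * M \<le> e/3" .
  qed
  obtain \<delta> where \<delta>: "\<delta> > 0" "\<And>t. t \<in> {-h..0} \<Longrightarrow> \<bar>t - d \<phi>\<bar> < \<delta> \<Longrightarrow> \<bar>seg_deriv h \<phi> t - seg_deriv h \<phi> (d \<phi>)\<bar> < e1"
    using seg_deriv_close[OF \<phi> d_mem[OF \<phi>] p(1)] by blast
  have e3: "e/3 > 0" using e by simp
  show ?thesis
    using tendstoD[OF d_tendsto[OF \<phi>] \<delta>(1)] tendstoD[OF d_tendsto[OF \<phi>] e3]
      order_tendstoD(2)[OF tendsto_nbhd p(1)] cont_De[OF \<phi> p(4)] eventually_nbhd_mem
  proof eventually_elim
    case (elim \<psi>)
    note \<psi>d = d_mem[OF elim(5)]
    show ?case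
    proof
      fix v assume v: "v \<in> C1_space h"
      let ?s = "seg_deriv h \<psi> (d \<psi>)" and ?r = "seg_deriv h \<phi> (d \<phi>)"
      have s1: "\<bar>?s - seg_deriv h \<phi> (d \<psi>)\<bar> < e1"
        using abs_seg_deriv_le[OF h diff_mem[OF elim(5) \<phi>] \<psi>d] seg_deriv_diff[OF h elim(5) \<phi> \<psi>d] elim(3) by simp
      have s2: "\<bar>seg_deriv h \<phi> (d \<psi>) - ?r\<bar> < e1"
        using \<delta>(2)[OF \<psi>d] elim(1) by (simp add: dist_real_def)
      have s: "\<bar>?s - ?r\<bar> \<le> 2 * e1" using s1 s2 by linarith
      have m: "\<bar>?s\<bar> \<le> m" using s p(3) unfolding m_def by linarith
      have A: "\<bar>?s * (De \<psi> v - De \<phi> v)\<bar> \<le> e/3 * C1_norm h v"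
      proof -
        have "\<bar>?s * (De \<psi> v - De \<phi> v)\<bar> \<le> m * (e2 * C1_norm h v)"
          unfolding abs_mult using m p(6) elim(4) v by (intro mult_mono) auto
        also have "\<dots> = (m * e2) * C1_norm h v" by simp
        also have "\<dots> \<le> e/3 * C1_norm h v" by (intro mult_right_mono p n_nonneg)
        finally show ?thesis .
      qed
      have B: "\<bar>(?s - ?r) * De \<phi> v\<bar> \<le> e/3 * C1_norm h v"
      proof -
        have "\<bar>(?s - ?r) * De \<phi> v\<bar> \<le> (2 * e1) * (M * C1_norm h v)"
          unfolding abs_mult using s p(1) M(2)[OF v] by (intro mult_mono) auto
        also have "\<dots> = (2 * e1 * M) * C1_norm h v" by simp
        also have "\<dots> \<le> e/3 * C1_norm h v" by (intro mult_right_mono p n_nonneg)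
        finally show ?thesis .
      qed
      have C: "\<bar>apply_bcontfun v (d \<psi>) - apply_bcontfun v (d \<phi>)\<bar> \<le> e/3 * C1_norm h v"
      proof -
        have "\<bar>apply_bcontfun v (d \<psi>) - apply_bcontfun v (d \<phi>)\<bar> \<le> C1_norm h v * \<bar>d \<psi> - d \<phi>\<bar>"
        proof (cases "d \<phi> \<le> d \<psi>")
          case True
          then show ?thesis
            using abs_seg_deriv_le[OF h v] d_mem[OF \<phi>] \<psi>d
              C1_space_mean_value[OF h v, of "d \<phi>" "d \<psi>" 0 "C1_norm h v"] by simp
        next
          case False
          then show ?thesis
            using abs_seg_deriv_le[OF h v] d_mem[OF \<phi>] \<psi>d
              C1_space_mean_value[OF h v, of "d \<psi>" "d \<phi>" 0 "C1_norm h v"]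
            by (simp add: abs_minus_commute)
        qed
        also have "\<dots> \<le> C1_norm h v * (e/3)"
          using elim(2) by (intro mult_left_mono n_nonneg) (auto simp: dist_real_def)
        finally show ?thesis by (simp add: mult.commute)
      qed
      have "DG \<psi> v - DG \<phi> v = ?s * (De \<psi> v - De \<phi> v) + (?s - ?r) * De \<phi> v
          + (apply_bcontfun v (d \<psi>) - apply_bcontfun v (d \<phi>))"
        unfolding DG_def by (simp add: algebra_simps)
      then show "\<bar>DG \<psi> v - DG \<phi> v\<bar> \<le> e * C1_norm h v" using A B C by linarith
    qed
  qed
qed

end

section \<open>The diffeomorphism\<close>

theorem theorem1:
  fixes h b :: real
    and f :: "real \<Rightarrow> real"
    and d F :: "(real \<Rightarrow>\<^sub>C real) \<Rightarrow> real"
    and De :: "(real \<Rightarrow>\<^sub>C real) \<Rightarrow> (real \<Rightarrow>\<^sub>C real) \<Rightarrow> real"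
  assumes "h > 0"
    and "f C1_differentiable_on UNIV"
    and "d \<in> C1_space h \<rightarrow> {-h<..<0}"
    and "C1_map_on (C1_space h) (C1_norm h) UNIV abs (C1_space h) d"
    and "extended_derivative h d De"
    and "\<And>\<phi>. \<phi> \<in> C1_space h \<Longrightarrow> F \<phi> = f (apply_bcontfun \<phi> (d \<phi>))"
    and "b > 0"
    and "X_set h d b F \<noteq> {}"
    and "bdd_above ((\<lambda>\<phi>. op_norm (C_space h) norm abs (De \<phi>)) `
           {\<phi> \<in> C1_space h. \<bar>seg_deriv h \<phi> (-h)\<bar> < b})"
  shows "\<exists>\<Phi> W. diffeomorphism_on (C1_space h) (C1_norm h) (C1_space h) (C1_norm h) (U_set h d b) W \<Phi> \<and>
           openin (subtopology (C1_top h) (X0_space h)) (\<Phi> ` X_set h d b F)"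
proof -
  obtain K0 where K0: "\<And>\<phi>. \<phi> \<in> C1_space h \<Longrightarrow> \<bar>seg_deriv h \<phi> (-h)\<bar> < b \<Longrightarrow> op_norm (C_space h) norm abs (De \<phi>) \<le> K0"
    using assms(9) by (auto simp: bdd_above_def)
  interpret delay h b "max 0 K0" d De
  proof
    show "op_norm (C_space h) norm abs (De \<phi>) \<le> max 0 K0"
      if "\<phi> \<in> C1_space h" "\<bar>seg_deriv h \<phi> (-h)\<bar> < b" for \<phi>
      using K0[OF that] by simp
  qed (use assms in auto)
  define L where "L = 1 + b * max 0 K0"
  have L: "L > 0" using b by (simp add: L_def add_pos_nonneg)
  \<comment> \<open>The largest \<open>c\<close> with \<open>L * c \<le> 1/2\<close>.\<close>
  define c where "c = 1 / (2 * L)"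
  have c: "c > 0" "L * c \<le> 1/2" using L by (simp_all add: c_def)
  obtain a where a: "\<And>u. (f has_real_derivative a u) (at u)" "continuous_on UNIV a"
    using assms(2) by (auto simp: C1_differentiable_on_def has_real_derivative_iff_has_vector_derivative)
  obtain H \<eta> where H: "\<And>s. H s \<in> C1_space h" "\<And>s. \<eta> s \<in> C1_space h" "\<And>s. norm (\<eta> s) \<le> c"
      "\<And>s. seg_deriv h (H s) 0 = f s" "\<And>s r. norm (H s - H r) \<le> c * \<bar>s - r\<bar>"
      "\<And>s e. e > 0 \<Longrightarrow> \<forall>\<^sub>F r in nhds s. C1_norm h (H r - H s - (r - s) *\<^sub>R \<eta> s) \<le> e * \<bar>r - s\<bar>"
      "\<And>s. ((\<lambda>r. C1_norm h (\<eta> r - \<eta> s)) \<longlongrightarrow> 0) (nhds s)"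
    using ex_small_curve[OF h c(1) a] by blast
  have ev: "eventually P (nbhd (U_set h d b) \<phi>)" if "eventually P (nbhd (C1_space h) \<phi>)" for P \<phi>
    using that nbhd_mono[of "U_set h d b" "C1_space h"] U_D(1) by (meson filter_leD subsetI)
  interpret curve_perturbation "C1_space h" "C1_norm h" "U_set h d b" G DG H \<eta> L c
  proof unfold_locales
    show "\<And>x v. x \<in> U_set h d b \<Longrightarrow> v \<in> C1_space h \<Longrightarrow> \<bar>DG x v\<bar> \<le> L * norm v"
      unfolding L_def by (rule DG_le)
    show "\<And>x y. x \<in> U_set h d b \<Longrightarrow> y \<in> U_set h d b \<Longrightarrow> \<bar>G x - G y\<bar> \<le> L * norm (x - y)"
      unfolding L_def by (rule G_lipschitz)
  qed (use open_U linear_DG U_D(1) ev deriv_G cont_DG H L c in auto)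
  have "\<Phi> \<phi> \<in> X0_space h \<longleftrightarrow> \<phi> \<in> X_set h d b F" if "\<phi> \<in> U_set h d b" for \<phi>
  proof -
    have "seg_deriv h (\<Phi> \<phi>) 0 = seg_deriv h \<phi> 0 - F \<phi>"
      using h assms(6)[OF U_D(1)[OF that]]
      by (simp add: \<Phi>_def seg_deriv_diff U_D(1)[OF that] H G_def)
    then show ?thesis using that \<Phi>_mem[OF that] by (auto simp: X0_space_def X_set_def)
  qed
  then have "\<Phi> ` X_set h d b F = \<Phi> ` U_set h d b \<inter> X0_space h"
    by (auto simp: X_set_def)
  then have "openin (subtopology (C1_top h) (X0_space h)) (\<Phi> ` X_set h d b F)"
    using open_image_\<Phi> unfolding C1_top_def openin_subtopology by blast
  with diffeomorphism_\<Phi> show ?thesis by blast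
qed

end
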